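(* Let $N\ge1$ be an integer and $h=\frac1N$. The optimal coefficients of the quadrature formulas of the form $\int_0^1\varphi(x)\,dx\cong\sum_{\beta=0}^NC_\beta\varphi(h\beta)$ in the space $W_2^{(2,1)}(0,1)$ are $$ C_\beta=\begin{cases} 1-\dfrac{h}{e^h-1}-K(h)(\lambda_1-\lambda_1^N),&\beta=0,\\[2mm] h+K(h)\left((e^h-\lambda_1)\lambda_1^\beta+(1-\lambda_1e^h)\lambda_1^{N-\beta}\right),&\beta=1,\dots,N-1,\\[2mm] -1+e^h\left(\dfrac{h}{e^h-1}-K(h)(\lambda_1-\lambda_1^N)\right),&\beta=N, \end{cases} $$ where $$ K(h)=\frac{(2e^h-2-he^h-h)(\lambda_1-1)}{2(e^h-1)^2(\lambda_1+\lambda_1^{N+1})}, $$ $$ \lambda_1=\frac{h(e^{2h}+1)-e^{2h}+1-(e^h-1)\sqrt{h^2(e^h+1)^2+2h(1-e^{2h})}}{1-e^{2h}+2he^h},\qquad |\lambda_1|<1. $$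
   Context: $W_2^{(2,1)}(0,1)$ is the space of functions $\varphi$ on $[0,1]$ with $\varphi'$ absolutely continuous and $\varphi''\in L_2(0,1)$, with (semi)norm $\|\varphi\|=\left\{\int_0^1(\varphi''(x)+\varphi'(x))^2dx\right\}^{1/2}$ (functions differing by an element of the kernel $\mathrm{span}\{1,e^{-x}\}$ are identified). The error functional is $(\ell_N,\varphi)=\int_0^1\varphi(x)dx-\sum_{\beta=0}^NC_\beta\varphi(h\beta)$, with norm $\|\ell_N\|=\sup_{\|\varphi\|=1}|(\ell_N,\varphi)|$ (finite only if the formula is exact for $1$ and $e^{-x}$). The optimal coefficients are the values $C_0,\dots,C_N$ at which $\inf_{C_\beta}\|\ell_N\|$ over all real coefficients, with the nodes $h\beta$ fixed, is attained. *)

theory Defs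
  imports "HOL-Analysis.Analysis"
begin

text \<open>
  The usual epsilon-delta notion for finite families of non-overlapping closed subintervals
  \<open>k = {Inf k..Sup k}\<close> of \<open>S\<close>; such a family is a division of its union.
\<close>

definition abs_continuous_on :: "real set \<Rightarrow> (real \<Rightarrow> real) \<Rightarrow> bool" where
  "abs_continuous_on S f \<longleftrightarrow>
     (\<forall>\<epsilon>>0. \<exists>\<delta>>0. \<forall>d t. d division_of t \<and> t \<subseteq> S \<and> (\<Sum>k\<in>d. Sup k - Inf k) < \<delta>
        \<longrightarrow> (\<Sum>k\<in>d. \<bar>f (Sup k) - f (Inf k)\<bar>) < \<epsilon>)"

definition square_integrable_on :: "(real \<Rightarrow> real) \<Rightarrow> real set \<Rightarrow> bool" where
  "square_integrable_on f S \<longleftrightarrow>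
     f \<in> borel_measurable (lebesgue_on S) \<and> integrable (lebesgue_on S) (\<lambda>x. (f x)\<^sup>2)"

text \<open>
  Functions on \<open>[0,1]\<close> are represented by functions on \<open>\<real>\<close> whose values outside \<open>[0,1]\<close> are
  irrelevant; accordingly derivatives are taken within \<open>[0,1]\<close>, hence one-sided at the endpoints.
  At points of non-differentiability \<open>D01\<close> has a fixed unspecified value.
\<close>

definition D01 :: "(real \<Rightarrow> real) \<Rightarrow> real \<Rightarrow> real" where
  "D01 f x = vector_derivative f (at x within {0..1})"

text \<open>
  The second derivative is only an almost everywhere derivative of the first one. Its almost
  everywhere existence follows from absolute continuity, but is part of what
  \<open>\<phi>'' \<in> L\<^sub>2(0,1)\<close> means and is therefore listed explicitly.
\<close>

definition W21 :: "(real \<Rightarrow> real) set" where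
  "W21 = {\<phi>. \<phi> differentiable_on {0..1} \<and>
             abs_continuous_on {0..1} (D01 \<phi>) \<and>
             (AE x in lebesgue_on {0..1}. D01 \<phi> differentiable (at x within {0..1})) \<and>
             square_integrable_on (D01 (D01 \<phi>)) {0..1}}"

definition W21_norm :: "(real \<Rightarrow> real) \<Rightarrow> real" where
  "W21_norm \<phi> = sqrt (LINT x|lebesgue_on {0..1}. (D01 (D01 \<phi>) x + D01 \<phi> x)\<^sup>2)"

definition error_functional :: "nat \<Rightarrow> (nat \<Rightarrow> real) \<Rightarrow> (real \<Rightarrow> real) \<Rightarrow> real" where
  "error_functional N C \<phi> =
     integral {0..1} \<phi> - (\<Sum>\<beta>=0..N. C \<beta> * \<phi> (1 / real N * real \<beta>))"

text \<open>
  \<open>W21_norm\<close> is a seminorm with kernel spanned by \<open>1\<close> and \<open>exp (-x)\<close>. The supremum runs over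
  representatives rather than over classes modulo that kernel: it is independent of the
  representative for a functional vanishing on the kernel, and \<open>\<infinity>\<close> for a linear functional that
  does not.
\<close>

definition W21_dual_norm :: "((real \<Rightarrow> real) \<Rightarrow> real) \<Rightarrow> ereal" where
  "W21_dual_norm L = (SUP \<phi>\<in>{\<phi> \<in> W21. W21_norm \<phi> = 1}. ereal \<bar>L \<phi>\<bar>)"

text \<open>Only the values \<open>C 0, \<dots>, C N\<close> matter.\<close>

definition optimal_coefficients :: "nat \<Rightarrow> (nat \<Rightarrow> real) \<Rightarrow> bool" where
  "optimal_coefficients N C \<longleftrightarrow>
     W21_dual_norm (error_functional N C) = (INF C'. W21_dual_norm (error_functional N C'))"

definition lambda1 :: "real \<Rightarrow> real" where
  "lambda1 h =
     (h * (exp (2 * h) + 1) - exp (2 * h) + 1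
        - (exp h - 1) * sqrt (h\<^sup>2 * (exp h + 1)\<^sup>2 + 2 * h * (1 - exp (2 * h))))
     / (1 - exp (2 * h) + 2 * h * exp h)"

definition K_factor :: "nat \<Rightarrow> real \<Rightarrow> real" where
  "K_factor N h =
     (2 * exp h - 2 - h * exp h - h) * (lambda1 h - 1)
     / (2 * (exp h - 1)\<^sup>2 * (lambda1 h + lambda1 h ^ (N + 1)))"

end

theory Submission
  imports Defs
begin

text \<open>
  If the formula is exact on \<open>1\<close> and \<open>exp (-x)\<close>, the error functional is integration of
  \<open>\<phi>'' + \<phi>'\<close> against its Peano kernel
  \<open>F t = exp t - 1 - t - (\<Sum>\<beta>. C \<beta> * max 0 (exp (t - h\<beta>) - 1))\<close>, so its norm is the \<open>L\<^sub>2\<close>-norm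
  of \<open>F\<close>; otherwise the norm is infinite. The kernels form an affine space of splines that vanish at
  \<open>0\<close> and \<open>1\<close>, are determined by their nodal values, and lie piecewise in \<open>-t + span {1, exp t}\<close>.
  The element of least norm is the one orthogonal to all differences, which means that its nodal
  values \<open>f k\<close> satisfy \<open>m f(k-1) + d f(k) + m f(k+1) = r\<close> with constant \<open>m\<close>, \<open>d\<close>, \<open>r\<close>. Since \<open>\<lambda>\<^sub>1\<close> is the
  root of \<open>m \<lambda>\<^sup>2 + d \<lambda> + m\<close> in the unit disc, \<open>f k\<close> is a constant multiple of
  \<open>1 - (\<lambda>\<^sub>1^k + \<lambda>\<^sub>1^(N-k)) / (1 + \<lambda>\<^sub>1^N)\<close>, and the coefficients are the jumps of the slope of
  this spline.
\<close>

subsection \<open>Absolutely continuous functions\<close>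

text \<open>Absolute continuity is phrased with sums of lengths, while exceptional sets are
  controlled by Lebesgue measure; this translates between the two.\<close>

lemma sum_length_division_eq_measure:
  fixes d :: "real set set"
  assumes "d division_of t"
  shows "t \<in> lmeasurable" "(\<Sum>k\<in>d. Sup k - Inf k) = measure lebesgue t"
proof -
  have "((\<lambda>_. 1::real) has_integral (Sup k - Inf k)) k" if "k \<in> d" for k
  proof -
    obtain a b where ab: "k = {a..b}" using division_ofD(4)[OF assms \<open>k \<in> d\<close>] by auto
    moreover have "k \<noteq> {}" using division_ofD(3)[OF assms \<open>k \<in> d\<close>] .
    ultimately have "a \<le> b" by simp
    then show ?thesis using has_integral_const_real[of "1::real" a b] ab by simp
  qed
  then have *: "((\<lambda>_. 1::real) has_integral (\<Sum>k\<in>d. Sup k - Inf k)) t"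
    by (rule has_integral_combine_division[OF assms])
  then show t: "t \<in> lmeasurable"
    using has_integral_integrable by (auto simp: lmeasurable_iff_integrable_on)
  show "(\<Sum>k\<in>d. Sup k - Inf k) = measure lebesgue t"
    using * lmeasure_integral[OF t] by (simp add: integral_unique)
qed

lemma negligible_outer_open:
  fixes S :: "'a::euclidean_space set"
  assumes "negligible S" "e > 0"
  obtains T where "open T" "S \<subseteq> T" "T \<in> lmeasurable" "measure lebesgue T < e"
proof -
  have S: "S \<in> null_sets lebesgue" "S \<in> sets lebesgue"
    using assms(1) negligible_iff_null_sets by auto
  obtain T where T: "open T" "S \<subseteq> T" "(T - S) \<in> lmeasurable" "emeasure lebesgue (T - S) < ennreal e"
    using sets_lebesgue_outer_open[OF S(2) assms(2)] by blast
  have "emeasure lebesgue T = emeasure lebesgue (T - S)"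
    using emeasure_Diff_null_set[OF S(1)] T(1) by simp
  with T have e: "emeasure lebesgue T < ennreal e" by simp
  have "T \<in> lmeasurable"
    using T(1) e by (intro fmeasurableI) (auto simp: top.not_eq_extremum intro: less_trans)
  moreover have "measure lebesgue T < e"
    using e assms(2) emeasure_eq_measure2[OF calculation] by (simp add: ennreal_less_iff)
  ultimately show ?thesis using T that by blast
qed

text \<open>
  The gauge confines the intervals tagged in the exceptional null set to an open set of small
  measure, where absolute continuity makes their contribution to the telescoping sum small.
\<close>

lemma has_integral_abs_continuous:
  fixes f :: "real \<Rightarrow> real"
  assumes "a \<le> b" and ac: "abs_continuous_on {a..b} f" and S: "negligible S"
    and f': "\<And>x. x \<in> {a..b} - S \<Longrightarrow> (f has_vector_derivative f' x) (at x within {a..b})"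
  shows "(f' has_integral f b - f a) {a..b}"
proof -
  \<comment> \<open>With value 0 on \<open>S\<close>, an interval tagged there contributes nothing
    to the Riemann sum, and only its increment of \<open>f\<close> has to be estimated.\<close>
  define g where "g x = (if x \<in> S then 0 else f' x)" for x
  have "(g has_integral f b - f a) {a..b}"
    unfolding has_integral_real
  proof (intro allI impI)
    fix e :: real assume "e > 0"
    \<comment> \<open>The added 1 keeps the denominator positive when \<open>a = b\<close>.\<close>
    define c where "c = e / (2 * (b - a + 1))"
    have "c > 0" using \<open>e > 0\<close> \<open>a \<le> b\<close> by (simp add: c_def)
    have cb: "c * (b - a) < e / 2"
      using \<open>e > 0\<close> \<open>a \<le> b\<close> by (simp add: c_def field_simps)
    obtain \<delta> where "\<delta> > 0" and \<delta>: "\<And>d t. d division_of t \<Longrightarrow> t \<subseteq> {a..b} \<Longrightarrow>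
        (\<Sum>k\<in>d. Sup k - Inf k) < \<delta> \<Longrightarrow> (\<Sum>k\<in>d. \<bar>f (Sup k) - f (Inf k)\<bar>) < e / 2"
      using ac[unfolded abs_continuous_on_def] \<open>e > 0\<close> half_gt_zero[of e] by metis
    obtain T where T: "open T" "S \<subseteq> T" "T \<in> lmeasurable" "measure lebesgue T < \<delta>"
      using negligible_outer_open[OF S \<open>\<delta> > 0\<close>] by blast
    have "\<forall>x. \<exists>d>0. x \<in> {a..b} - S \<longrightarrow>
         (\<forall>y\<in>{a..b}. norm (y-x) < d \<longrightarrow> norm (f y - f x - (y-x) *\<^sub>R f' x) \<le> c * norm (y-x))"
      using f'[unfolded has_vector_derivative_def has_derivative_within_alt] \<open>c > 0\<close>
      by (metis zero_less_one)
    then obtain d where d: "\<And>x. 0 < d x"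
        "\<And>x y. \<lbrakk>x \<in> {a..b} - S; y \<in> {a..b}; norm (y-x) < d x\<rbrakk>
           \<Longrightarrow> norm (f y - f x - (y-x) *\<^sub>R f' x) \<le> c * norm (y-x)"
      by metis
    define \<gamma> where "\<gamma> x = (if x \<in> S then T else ball x (d x))" for x
    show "\<exists>\<gamma>. gauge \<gamma> \<and> (\<forall>p. p tagged_division_of {a..b} \<and> \<gamma> fine p \<longrightarrow>
        norm ((\<Sum>(x,k)\<in>p. measure lborel k *\<^sub>R g x) - (f b - f a)) < e)"
    proof (intro exI[of _ \<gamma>] conjI allI impI)
      show "gauge \<gamma>" using T d(1) by (auto simp: gauge_def \<gamma>_def)
    next
      fix p assume "p tagged_division_of {a..b} \<and> \<gamma> fine p"
      then have p: "p tagged_division_of {a..b}" and fine: "\<gamma> fine p" by auto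
      have fin: "finite p" using p by blast
      define D where "D = (\<lambda>(x::real,K). f (Sup K) - f (Inf K))"
      define L where "L = (\<lambda>(x::real,K::real set). Sup K - Inf K)"
      define q where "q = {(x,K) \<in> p. x \<in> S}"
      have "q \<subseteq> p" by (auto simp: q_def)
      have D: "f b - f a = sum D p"
        using additive_tagged_division_1[OF \<open>a \<le> b\<close> p, of f] by (simp add: D_def)
      have L: "b - a = sum L p"
        using additive_tagged_division_1[OF \<open>a \<le> b\<close> p, of "\<lambda>x. x"] by (simp add: L_def)
      have K: "\<exists>u v. K = {u..v} \<and> u \<le> v \<and> x \<in> K \<and> a \<le> u \<and> v \<le> b" if "(x,K) \<in> p" for x K
      proof -
        have "x \<in> K" "K \<subseteq> {a..b}" "\<exists>u v. K = cbox u v" using p that by blast+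
        then show ?thesis by auto
      qed
      have smooth: "\<bar>measure lborel (snd z) * g (fst z) - D z\<bar> \<le> c * L z" if z: "z \<in> p - q" for z
      proof -
        obtain x K where xK: "z = (x,K)" "(x,K) \<in> p" "x \<notin> S" using z by (cases z) (auto simp: q_def)
        obtain u v where uv: "K = {u..v}" "u \<le> v" "x \<in> K" "a \<le> u" "v \<le> b" using K xK by blast
        have "K \<subseteq> ball x (d x)" using fineD[OF fine xK(2)] xK(3) by (simp add: \<gamma>_def)
        then have "dist x u < d x" "dist x v < d x" using uv by (auto simp: subset_iff)
        then have "norm (u - x) < d x" "norm (v - x) < d x" by (auto simp: dist_real_def)
        then have "\<bar>f u - f x - (u - x) * f' x\<bar> \<le> c * \<bar>u - x\<bar>"
          "\<bar>f v - f x - (v - x) * f' x\<bar> \<le> c * \<bar>v - x\<bar>"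
          using d(2)[of x u] d(2)[of x v] uv xK by auto
        moreover have "c * \<bar>u - x\<bar> + c * \<bar>v - x\<bar> = c * (v - u)"
          using uv by (simp add: algebra_simps)
        moreover have "(v - u) * f' x - (f v - f u) =
            (f u - f x - (u - x) * f' x) - (f v - f x - (v - x) * f' x)"
          by (simp add: algebra_simps)
        ultimately have "\<bar>(v - u) * f' x - (f v - f u)\<bar> \<le> c * (v - u)" by linarith
        then show ?thesis using uv xK by (simp add: D_def L_def g_def)
      qed
      have rough: "(\<Sum>z\<in>q. \<bar>D z\<bar>) < e / 2"
      proof -
        have qp: "q tagged_partial_division_of {a..b}"
          using p tagged_partial_division_subset[OF _ \<open>q \<subseteq> p\<close>] by (simp add: tagged_division_of_def)
        let ?t = "\<Union>(snd ` q)"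
        have t: "(snd ` q) division_of ?t" by (rule partial_division_of_tagged_division[OF qp])
        have "?t \<subseteq> T" 
        proof
          fix y assume "y \<in> ?t"
          then obtain x K where xK: "(x,K) \<in> p" "x \<in> S" "y \<in> K" by (auto simp: q_def)
          then have "K \<subseteq> \<gamma> x" using fine by (auto simp: fine_def)
          then show "y \<in> T" using xK by (auto simp: \<gamma>_def)
        qed
        then have "(\<Sum>k\<in>snd ` q. Sup k - Inf k) < \<delta>"
          using measure_mono_fmeasurable[OF \<open>?t \<subseteq> T\<close> fmeasurableD[OF sum_length_division_eq_measure(1)[OF t]] T(3)]
            T(4) by (simp only: sum_length_division_eq_measure(2)[OF t])
        moreover have "?t \<subseteq> {a..b}" 
        proof
          fix y assume "y \<in> ?t"
          then obtain x K where xK: "(x,K) \<in> p" "y \<in> K" by (auto simp: q_def)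
          then show "y \<in> {a..b}" using K by fastforce
        qed
        ultimately have "(\<Sum>k\<in>snd ` q. \<bar>f (Sup k) - f (Inf k)\<bar>) < e / 2" using \<delta>[OF t] by blast
        \<comment> \<open>Forgetting the tags is allowed for a summand that vanishes on every
          interval with empty interior. The guard makes this true for the empty one, where
          \<open>Sup\<close> and \<open>Inf\<close> are unspecified.\<close>
        moreover have "(\<Sum>(x,k)\<in>q. if k = {} then 0 else \<bar>f (Sup k) - f (Inf k)\<bar>)
            = (\<Sum>k\<in>snd ` q. if k = {} then 0 else \<bar>f (Sup k) - f (Inf k)\<bar>)"
          by (rule sum.over_tagged_division_lemma[OF tagged_partial_division_of_Union_self[OF qp]])
             (auto simp: box_eq_empty)
        moreover have "(\<Sum>(x,k)\<in>q. if k = {} then 0 else \<bar>f (Sup k) - f (Inf k)\<bar>) = (\<Sum>z\<in>q. \<bar>D z\<bar>)"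
          using K \<open>q \<subseteq> p\<close> by (intro sum.cong) (fastforce simp: D_def)+
        moreover have "(\<Sum>k\<in>snd ` q. if k = {} then 0 else \<bar>f (Sup k) - f (Inf k)\<bar>)
            = (\<Sum>k\<in>snd ` q. \<bar>f (Sup k) - f (Inf k)\<bar>)"
          using division_ofD(3)[OF t] by (intro sum.cong) auto
        ultimately show ?thesis by simp
      qed
      have "(\<Sum>(x,k)\<in>p. measure lborel k *\<^sub>R g x) - (f b - f a)
          = (\<Sum>z\<in>p. measure lborel (snd z) * g (fst z) - D z)"
        by (simp add: D split_def sum_subtractf)
      also have "\<bar>\<dots>\<bar> \<le> (\<Sum>z\<in>p. \<bar>measure lborel (snd z) * g (fst z) - D z\<bar>)" by (rule sum_abs)
      also have "\<dots> = (\<Sum>z\<in>p - q. \<bar>measure lborel (snd z) * g (fst z) - D z\<bar>)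
          + (\<Sum>z\<in>q. \<bar>measure lborel (snd z) * g (fst z) - D z\<bar>)"
        by (rule sum.subset_diff[OF \<open>q \<subseteq> p\<close> fin])
      also have "(\<Sum>z\<in>q. \<bar>measure lborel (snd z) * g (fst z) - D z\<bar>) = (\<Sum>z\<in>q. \<bar>D z\<bar>)"
        by (rule sum.cong) (auto simp: q_def g_def)
      also have "(\<Sum>z\<in>p - q. \<bar>measure lborel (snd z) * g (fst z) - D z\<bar>) \<le> (\<Sum>z\<in>p - q. c * L z)"
        by (rule sum_mono[OF smooth])
      also have "\<dots> \<le> (\<Sum>z\<in>p. c * L z)"
        using \<open>c > 0\<close> fin K by (intro sum_mono2) (fastforce simp: L_def)+
      also have "\<dots> = c * (b - a)" by (simp add: L sum_distrib_left)
      finally show "norm ((\<Sum>(x,k)\<in>p. measure lborel k *\<^sub>R g x) - (f b - f a)) < e"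
        using rough cb by simp
    qed
  qed
  then show ?thesis
    by (rule has_integral_spike[OF S, rotated]) (simp add: g_def)
qed

section \<open>Permanence properties of absolute continuity\<close>

lemma abs_continuous_on_subset:
  "abs_continuous_on S f \<Longrightarrow> T \<subseteq> S \<Longrightarrow> abs_continuous_on T f"
  unfolding abs_continuous_on_def by (meson order_trans)

lemma division_of_endpoints:
  fixes d :: "real set set"
  assumes "d division_of t" "t \<subseteq> S" "k \<in> d"
  shows "Sup k \<in> S" "Inf k \<in> S" "Inf k \<le> Sup k"
proof -
  obtain a b where "k = {a..b}" using division_ofD(4)[OF assms(1,3)] by auto
  moreover have "k \<noteq> {}" "k \<subseteq> t"
    using division_ofD(2,3)[OF assms(1,3)] by auto
  ultimately show "Sup k \<in> S" "Inf k \<in> S" "Inf k \<le> Sup k" using assms(2) by auto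
qed

text \<open>A common source for Lipschitz functions, sums and products: in each case the increments
  are controlled by those of two absolutely continuous functions.\<close>

lemma abs_continuous_on_dominated:
  fixes f g h :: "real \<Rightarrow> real"
  assumes "abs_continuous_on S f" "abs_continuous_on S g"
    and h: "\<And>x y. x \<in> S \<Longrightarrow> y \<in> S \<Longrightarrow> \<bar>h x - h y\<bar> \<le> M * (\<bar>f x - f y\<bar> + \<bar>g x - g y\<bar>)"
  shows "abs_continuous_on S h"
  unfolding abs_continuous_on_def
proof (intro allI impI)
  fix e :: real assume "e > 0"
  \<comment> \<open>Positive for every real \<open>M\<close>, and small enough that two
    contributions below \<open>e'\<close>, each weighted by \<open>\<bar>M\<bar>\<close>, stay below
    \<open>e\<close>.\<close>
  define e' where "e' = e / (2 * \<bar>M\<bar> + 1)"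
  have "e' > 0" using \<open>e > 0\<close> by (simp add: e'_def)
  obtain \<delta>1 where \<delta>1: "\<delta>1 > 0" "\<And>d t. d division_of t \<Longrightarrow> t \<subseteq> S \<Longrightarrow>
      (\<Sum>k\<in>d. Sup k - Inf k) < \<delta>1 \<Longrightarrow> (\<Sum>k\<in>d. \<bar>f (Sup k) - f (Inf k)\<bar>) < e'"
    using assms(1)[unfolded abs_continuous_on_def] \<open>e' > 0\<close> by metis
  obtain \<delta>2 where \<delta>2: "\<delta>2 > 0" "\<And>d t. d division_of t \<Longrightarrow> t \<subseteq> S \<Longrightarrow>
      (\<Sum>k\<in>d. Sup k - Inf k) < \<delta>2 \<Longrightarrow> (\<Sum>k\<in>d. \<bar>g (Sup k) - g (Inf k)\<bar>) < e'"
    using assms(2)[unfolded abs_continuous_on_def] \<open>e' > 0\<close> by metis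
  have "(\<Sum>k\<in>d. \<bar>h (Sup k) - h (Inf k)\<bar>) < e"
    if d: "d division_of t" "t \<subseteq> S" and *: "(\<Sum>k\<in>d. Sup k - Inf k) < min \<delta>1 \<delta>2" for d t
  proof -
    have "(\<Sum>k\<in>d. \<bar>h (Sup k) - h (Inf k)\<bar>)
        \<le> (\<Sum>k\<in>d. \<bar>M\<bar> * (\<bar>f (Sup k) - f (Inf k)\<bar> + \<bar>g (Sup k) - g (Inf k)\<bar>))"
    proof (rule sum_mono)
      fix k assume "k \<in> d"
      then have "\<bar>h (Sup k) - h (Inf k)\<bar> \<le> M * (\<bar>f (Sup k) - f (Inf k)\<bar> + \<bar>g (Sup k) - g (Inf k)\<bar>)"
        using h division_of_endpoints[OF d] by blast
      also have "\<dots> \<le> \<bar>M\<bar> * (\<bar>f (Sup k) - f (Inf k)\<bar> + \<bar>g (Sup k) - g (Inf k)\<bar>)"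
        by (intro mult_right_mono) auto
      finally show "\<bar>h (Sup k) - h (Inf k)\<bar> \<le> \<bar>M\<bar> * (\<bar>f (Sup k) - f (Inf k)\<bar> + \<bar>g (Sup k) - g (Inf k)\<bar>)" .
    qed
    also have "\<dots> = \<bar>M\<bar> * ((\<Sum>k\<in>d. \<bar>f (Sup k) - f (Inf k)\<bar>) + (\<Sum>k\<in>d. \<bar>g (Sup k) - g (Inf k)\<bar>))"
      by (simp only: sum_distrib_left[symmetric] sum.distrib)
    also have "\<dots> \<le> \<bar>M\<bar> * (e' + e')"
      using \<delta>1(2)[OF d] \<delta>2(2)[OF d] * by (intro mult_left_mono add_mono) auto
    also have "\<dots> < (2 * \<bar>M\<bar> + 1) * e'" using \<open>e' > 0\<close> by (simp add: algebra_simps)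
    also have "\<dots> = e" by (simp add: e'_def)
    finally show ?thesis .
  qed
  then show "\<exists>\<delta>>0. \<forall>d t. d division_of t \<and> t \<subseteq> S \<and> (\<Sum>k\<in>d. Sup k - Inf k) < \<delta>
      \<longrightarrow> (\<Sum>k\<in>d. \<bar>h (Sup k) - h (Inf k)\<bar>) < e"
    using \<delta>1(1) \<delta>2(1) by (intro exI[of _ "min \<delta>1 \<delta>2"]) auto
qed

lemma abs_continuous_on_imp_continuous_on:
  fixes f :: "real \<Rightarrow> real"
  assumes "abs_continuous_on {a..b} f"
  shows "continuous_on {a..b} f"
  unfolding continuous_on_iff
proof (intro ballI allI impI)
  fix x e :: real assume x: "x \<in> {a..b}" and "e > 0"
  obtain \<delta> where \<delta>: "\<delta> > 0" "\<And>d t. d division_of t \<Longrightarrow> t \<subseteq> {a..b} \<Longrightarrow>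
      (\<Sum>k\<in>d. Sup k - Inf k) < \<delta> \<Longrightarrow> (\<Sum>k\<in>d. \<bar>f (Sup k) - f (Inf k)\<bar>) < e"
    using assms[unfolded abs_continuous_on_def] \<open>e > 0\<close> by metis
  have *: "\<bar>f v - f u\<bar> < e" if "u \<in> {a..b}" "v \<in> {a..b}" "u \<le> v" "v - u < \<delta>" for u v
  proof -
    have "{{u..v}} division_of {u..v}" using division_of_self[of u v] that by simp
    from \<delta>(2)[OF this] that show ?thesis by simp
  qed
  have "dist (f y) (f x) < e" if "y \<in> {a..b}" "dist y x < \<delta>" for y
  proof (cases "x \<le> y")
    case True
    then show ?thesis using *[of x y] x that by (simp add: dist_real_def)
  next
    case False
    then show ?thesis using *[of y x] x that by (simp add: dist_real_def)
  qed
  then show "\<exists>d>0. \<forall>y\<in>{a..b}. dist y x < d \<longrightarrow> dist (f y) (f x) < e"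
    using \<delta>(1) by blast
qed

lemma abs_continuous_on_ident: "abs_continuous_on S (\<lambda>x. x)"
  unfolding abs_continuous_on_def
proof (intro allI impI)
  fix e :: real assume "e > 0"
  have "(\<Sum>k\<in>d. \<bar>Sup k - Inf k\<bar>) = (\<Sum>k\<in>d. Sup k - Inf k)" if "d division_of t" "t \<subseteq> S"
    for d :: "real set set" and t
    using division_of_endpoints[OF that] by (intro sum.cong) auto
  then show "\<exists>\<delta>>0. \<forall>d t. d division_of t \<and> t \<subseteq> S \<and> (\<Sum>k\<in>d. Sup k - Inf k) < \<delta>
      \<longrightarrow> (\<Sum>k\<in>d. \<bar>Sup k - Inf k\<bar>) < e"
    using \<open>e > 0\<close> by (intro exI[of _ e]) auto
qed

lemma abs_continuous_on_C1:
  fixes f :: "real \<Rightarrow> real"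
  assumes f': "\<And>x. x \<in> {a..b} \<Longrightarrow> (f has_real_derivative f' x) (at x within {a..b})"
    and "continuous_on {a..b} f'"
  shows "abs_continuous_on {a..b} f"
proof -
  have "bounded (f' ` {a..b})"
    using assms(2) compact_continuous_image compact_imp_bounded by blast
  then obtain M where M: "M > 0" "\<And>x. x \<in> {a..b} \<Longrightarrow> \<bar>f' x\<bar> \<le> M"
    unfolding bounded_pos by auto
  have "\<bar>f x - f y\<bar> \<le> M * \<bar>x - y\<bar>" if "x \<in> {a..b}" "y \<in> {a..b}" for x y
    using field_differentiable_bound[of "{a..b}" f f' M, OF _ f' _ that] M by simp
  then show ?thesis
    using M(1)
    by (intro abs_continuous_on_dominated[OF abs_continuous_on_ident abs_continuous_on_ident, of _ _ M])
       (smt (verit) mult_nonneg_nonneg distrib_left)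
qed

lemma abs_continuous_on_add:
  "abs_continuous_on S f \<Longrightarrow> abs_continuous_on S g \<Longrightarrow> abs_continuous_on S (\<lambda>x. f x + g x)"
  by (rule abs_continuous_on_dominated[where f = f and g = g and M = 1])
     (simp_all add: add_diff_add abs_triangle_ineq)

lemma abs_continuous_on_mult:
  fixes f g :: "real \<Rightarrow> real"
  assumes "abs_continuous_on S f" "abs_continuous_on S g" "bounded (f ` S)" "bounded (g ` S)"
  shows "abs_continuous_on S (\<lambda>x. f x * g x)"
proof -
  obtain A B where A: "A > 0" "\<And>x. x \<in> S \<Longrightarrow> \<bar>f x\<bar> \<le> A" and B: "B > 0" "\<And>x. x \<in> S \<Longrightarrow> \<bar>g x\<bar> \<le> B"
    using assms(3,4) unfolding bounded_pos by auto
  show ?thesis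
  proof (rule abs_continuous_on_dominated[OF assms(1,2), of _ "A + B"])
    fix x y assume xy: "x \<in> S" "y \<in> S"
    have "f x * g x - f y * g y = f x * (g x - g y) + (f x - f y) * g y"
      by (simp add: algebra_simps)
    then have "\<bar>f x * g x - f y * g y\<bar> \<le> \<bar>f x\<bar> * \<bar>g x - g y\<bar> + \<bar>f x - f y\<bar> * \<bar>g y\<bar>"
      by (metis abs_mult abs_triangle_ineq)
    also have "\<dots> \<le> A * \<bar>g x - g y\<bar> + \<bar>f x - f y\<bar> * B"
      using A B xy by (intro add_mono mult_right_mono mult_left_mono) auto
    also have "\<dots> \<le> (A + B) * (\<bar>f x - f y\<bar> + \<bar>g x - g y\<bar>)"
      using A(1) B(1) by (simp add: algebra_simps)
    finally show "\<bar>f x * g x - f y * g y\<bar> \<le> (A + B) * (\<bar>f x - f y\<bar> + \<bar>g x - g y\<bar>)" .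
  qed
qed

subsection \<open>The space of test functions\<close>

lemma D01_eqI:
  assumes "(f has_real_derivative d) (at x within {0..1})" "x \<in> {0..1}"
  shows "D01 f x = d"
  unfolding D01_def
  using vector_derivative_within_closed_interval[of 0 1 x f d] assms
  by (simp add: has_real_derivative_iff_has_vector_derivative)

text \<open>Membership in \<open>W21\<close> is unpacked into the form that
  \<open>has_integral_abs_continuous\<close> consumes: a negligible exceptional set in place of an
  almost-everywhere quantifier.\<close>

lemma W21_D01:
  assumes "\<phi> \<in> W21"
  shows W21_has_D01: "x \<in> {0..1} \<Longrightarrow> (\<phi> has_real_derivative D01 \<phi> x) (at x within {0..1})"
    and W21_D01_abs_continuous: "abs_continuous_on {0..1} (D01 \<phi>)"
    and W21_has_D01_D01: "\<exists>S. negligible S \<and> (\<forall>x\<in>{0..1} - S.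
      (D01 \<phi> has_real_derivative D01 (D01 \<phi>) x) (at x within {0..1}))"
proof -
  show "x \<in> {0..1} \<Longrightarrow> (\<phi> has_real_derivative D01 \<phi> x) (at x within {0..1})"
    using assms unfolding W21_def D01_def differentiable_on_def has_real_derivative_iff_has_vector_derivative
    by (auto simp: vector_derivative_works)
  show "abs_continuous_on {0..1} (D01 \<phi>)" using assms by (simp add: W21_def)
  have "AE x in lebesgue_on {0..1}. D01 \<phi> differentiable (at x within {0..1})"
    using assms by (simp add: W21_def)
  then have "AE x in lebesgue. x \<in> {0..1} \<longrightarrow> D01 \<phi> differentiable (at x within {0..1})"
    by (simp add: AE_restrict_space_iff)
  then obtain S where "S \<in> null_sets lebesgue"
    "{x. \<not> (x \<in> {0..1} \<longrightarrow> D01 \<phi> differentiable (at x within {0..1}))} \<subseteq> S"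
    by (auto simp: eventually_ae_filter)
  then show "\<exists>S. negligible S \<and> (\<forall>x\<in>{0..1} - S.
      (D01 \<phi> has_real_derivative D01 (D01 \<phi>) x) (at x within {0..1}))"
    unfolding negligible_iff_null_sets[symmetric] has_real_derivative_iff_has_vector_derivative
      D01_def[of "D01 \<phi>"]
    by (intro exI[of _ S]) (auto simp: vector_derivative_works)
qed

text \<open>The function \<open>k * \<phi>' - c * \<phi>\<close> is absolutely continuous, and
  \<open>k' = k + c\<close> turns its derivative into the integrand. Thus \<open>k\<close> solves
  the adjoint equation \<open>k'' - k' = c'\<close>. It will be applied with \<open>c = 1\<close> on
  \<open>{y..1}\<close> for point evaluations and with \<open>c t = t\<close> for the integral of
  \<open>\<phi>\<close>.\<close>

lemma has_integral_W21_by_parts: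
  assumes "\<phi> \<in> W21" "0 \<le> y" "y \<le> 1"
    and k: "\<And>t. (k has_real_derivative k t + c t) (at t)"
    and c: "\<And>t. (c has_real_derivative c' t) (at t)" and "continuous_on UNIV c'"
  shows "((\<lambda>t. k t * (D01 (D01 \<phi>) t + D01 \<phi> t) - c' t * \<phi> t) has_integral
      (k 1 * D01 \<phi> 1 - c 1 * \<phi> 1) - (k y * D01 \<phi> y - c y * \<phi> y)) {y..1}"
proof -
  note ac = W21_D01_abs_continuous[OF assms(1)]
  note contD = abs_continuous_on_imp_continuous_on[OF ac]
  note der = W21_has_D01[OF assms(1)]
  have cont: "continuous_on {0..1} \<phi>"
    using der DERIV_continuous_on by blast
  have contc: "continuous_on UNIV c" "continuous_on UNIV k"
    using DERIV_continuous_on[OF c] DERIV_continuous_on[OF k] by auto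
  have sub: "continuous_on {0..1} f" if "continuous_on UNIV f" for f :: "real \<Rightarrow> real"
    using that continuous_on_subset by blast
  have bd: "bounded (f ` {0..1})" if "continuous_on {0..1} f" for f :: "real \<Rightarrow> real"
    using that compact_continuous_image compact_imp_bounded by blast
  have "abs_continuous_on {0..1} k"
    using k contc by (intro abs_continuous_on_C1[where f' = "\<lambda>t. k t + c t"])
      (auto intro!: continuous_intros sub intro: has_field_derivative_at_within)
  moreover have "abs_continuous_on {0..1} (\<lambda>t. - c t)"
    using c \<open>continuous_on UNIV c'\<close> by (intro abs_continuous_on_C1[where f' = "\<lambda>t. - c' t"])
      (auto intro!: continuous_intros sub DERIV_minus intro: has_field_derivative_at_within)
  moreover have "abs_continuous_on {0..1} \<phi>"
    using der contD by (rule abs_continuous_on_C1)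
  ultimately have "abs_continuous_on {0..1} (\<lambda>t. k t * D01 \<phi> t + (- c t) * \<phi> t)"
    using ac cont contD contc
    by (intro abs_continuous_on_add abs_continuous_on_mult bd) (auto intro!: continuous_intros sub)
  then have *: "abs_continuous_on {y..1} (\<lambda>t. k t * D01 \<phi> t - c t * \<phi> t)"
    using \<open>0 \<le> y\<close> by (auto elim: abs_continuous_on_subset)
  obtain S where S: "negligible S"
    "\<And>x. x \<in> {0..1} - S \<Longrightarrow> (D01 \<phi> has_real_derivative D01 (D01 \<phi>) x) (at x within {0..1})"
    using W21_has_D01_D01[OF assms(1)] by blast
  show ?thesis
  proof (rule has_integral_abs_continuous[OF \<open>y \<le> 1\<close> * S(1)])
    fix x assume x: "x \<in> {y..1} - S"
    have "((\<lambda>t. k t * D01 \<phi> t - c t * \<phi> t) has_real_derivative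
      (k x + c x) * D01 \<phi> x + D01 (D01 \<phi>) x * k x - (c' x * \<phi> x + D01 \<phi> x * c x)) (at x within {0..1})"
      using x \<open>0 \<le> y\<close>
      by (intro DERIV_diff DERIV_mult der S k[THEN has_field_derivative_at_within]
          c[THEN has_field_derivative_at_within]) auto
    then have "((\<lambda>t. k t * D01 \<phi> t - c t * \<phi> t) has_real_derivative
      k x * (D01 (D01 \<phi>) x + D01 \<phi> x) - c' x * \<phi> x) (at x within {0..1})"
      by (simp add: algebra_simps)
    then show "((\<lambda>t. k t * D01 \<phi> t - c t * \<phi> t) has_vector_derivative
      k x * (D01 (D01 \<phi>) x + D01 \<phi> x) - c' x * \<phi> x) (at x within {y..1})"
      using \<open>0 \<le> y\<close> unfolding has_real_derivative_iff_has_vector_derivative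
      by (auto elim: has_vector_derivative_within_subset)
  qed
qed

subsection \<open>Peano kernel and dual norm\<close>

text \<open>This solves the adjoint equation F'' - F' = 1 - (sum of point masses
  \<open>C \<beta>\<close> at the nodes) with value and left derivative zero at 0:
  \<open>exp t - 1 - t\<close> accounts for the constant 1 and each truncated exponential for a unit
  mass.\<close>

definition peano_kernel :: "nat \<Rightarrow> (nat \<Rightarrow> real) \<Rightarrow> real \<Rightarrow> real" where
  "peano_kernel N C t =
     exp t - 1 - t - (\<Sum>\<beta>=0..N. C \<beta> * max 0 (exp (t - 1 / real N * real \<beta>) - 1))"

definition exact_on_kernel :: "nat \<Rightarrow> (nat \<Rightarrow> real) \<Rightarrow> bool" where
  "exact_on_kernel N C \<longleftrightarrow> (\<Sum>\<beta>=0..N. C \<beta>) = 1 \<and>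
     (\<Sum>\<beta>=0..N. C \<beta> * exp (- (1 / real N * real \<beta>))) = 1 - exp (- 1)"

lemma continuous_on_peano_kernel [continuous_intros]: "continuous_on S (peano_kernel N C)"
  unfolding peano_kernel_def by (intro continuous_intros)

text \<open>At the lower limit \<open>y\<close> the factor \<open>exp (t - y) - 1\<close> vanishes
  and removes the derivative of \<open>\<phi>\<close>, so point evaluation at \<open>y\<close>
  remains, up to boundary terms at 1.\<close>

lemma has_integral_max_exp_W21:
  assumes "\<phi> \<in> W21" "0 \<le> y" "y \<le> 1"
  shows "((\<lambda>t. max 0 (exp (t - y) - 1) * (D01 (D01 \<phi>) t + D01 \<phi> t)) has_integral
      (exp (1 - y) - 1) * D01 \<phi> 1 - \<phi> 1 + \<phi> y) {0..1}"
proof -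
  have "((\<lambda>t. (exp (t - y) - 1) * (D01 (D01 \<phi>) t + D01 \<phi> t) - 0 * \<phi> t) has_integral
      ((exp (1 - y) - 1) * D01 \<phi> 1 - 1 * \<phi> 1) - ((exp (y - y) - 1) * D01 \<phi> y - 1 * \<phi> y)) {y..1}"
    by (rule has_integral_W21_by_parts[OF assms])
       (auto intro!: derivative_eq_intros continuous_intros)
  then have "((\<lambda>t. max 0 (exp (t - y) - 1) * (D01 (D01 \<phi>) t + D01 \<phi> t)) has_integral
      (exp (1 - y) - 1) * D01 \<phi> 1 - \<phi> 1 + \<phi> y) {y..1}"
    by (subst has_integral_cong[where g = "\<lambda>t. (exp (t - y) - 1) * (D01 (D01 \<phi>) t + D01 \<phi> t) - 0 * \<phi> t"])
       (auto simp: max_def)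
  moreover have "((\<lambda>t. max 0 (exp (t - y) - 1) * (D01 (D01 \<phi>) t + D01 \<phi> t)) has_integral 0) {0..y}"
    by (rule has_integral_is_0) (auto simp: max_def)
  ultimately show ?thesis
    using has_integral_combine[OF assms(2,3)] by fastforce
qed

text \<open>The boundary terms at 1 cancel by exactness: those in \<open>\<phi> 1\<close> because
  the coefficients sum to 1, those in \<open>D01 \<phi> 1\<close> because the weighted sum
  \<open>e\<close> below equals the factor \<open>exp 1 - 2\<close> coming from
  \<open>exp t - 1 - t\<close>.\<close>

lemma has_integral_peano_kernel:
  assumes "N \<ge> 1" "exact_on_kernel N C" "\<phi> \<in> W21"
  shows "((\<lambda>t. peano_kernel N C t * (D01 (D01 \<phi>) t + D01 \<phi> t)) has_integral
      error_functional N C \<phi>) {0..1}"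
proof -
  let ?g = "\<lambda>t. D01 (D01 \<phi>) t + D01 \<phi> t" and ?x = "\<lambda>\<beta>. 1 / real N * real \<beta>"
  have "continuous_on {0..1} \<phi>"
    using W21_has_D01[OF assms(3)] DERIV_continuous_on by blast
  then have \<phi>: "(\<phi> has_integral integral {0..1} \<phi>) {0..1}"
    by (simp add: integrable_continuous_interval integrable_integral)
  have "((\<lambda>t. (exp t - 1 - t) * ?g t - 1 * \<phi> t) has_integral
      ((exp 1 - 1 - 1) * D01 \<phi> 1 - 1 * \<phi> 1) - ((exp 0 - 1 - 0) * D01 \<phi> 0 - 0 * \<phi> 0)) {0..1}"
    by (rule has_integral_W21_by_parts[OF assms(3)])
       (auto intro!: derivative_eq_intros continuous_intros)
  from has_integral_add[OF this \<phi>]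
  have 1: "((\<lambda>t. (exp t - 1 - t) * ?g t) has_integral
      (exp 1 - 2) * D01 \<phi> 1 - \<phi> 1 + integral {0..1} \<phi>) {0..1}"
    by (simp add: algebra_simps)
  have 2: "((\<lambda>t. \<Sum>\<beta>=0..N. C \<beta> * (max 0 (exp (t - ?x \<beta>) - 1) * ?g t)) has_integral
      (\<Sum>\<beta>=0..N. C \<beta> * ((exp (1 - ?x \<beta>) - 1) * D01 \<phi> 1 - \<phi> 1 + \<phi> (?x \<beta>)))) {0..1}"
    by (intro has_integral_sum has_integral_mult_right has_integral_max_exp_W21 assms(3))
       (use assms(1) in \<open>auto simp: divide_le_eq\<close>)
  have e: "(\<Sum>\<beta>=0..N. C \<beta> * (exp (1 - ?x \<beta>) - 1)) = exp 1 - 2"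
  proof -
    have "(\<Sum>\<beta>=0..N. C \<beta> * (exp (1 - ?x \<beta>) - 1))
        = exp 1 * (\<Sum>\<beta>=0..N. C \<beta> * exp (- ?x \<beta>)) - (\<Sum>\<beta>=0..N. C \<beta>)"
      by (simp add: sum_distrib_left sum_subtractf[symmetric] exp_diff exp_minus algebra_simps divide_inverse)
    also have "\<dots> = exp 1 - 2"
      using assms(2) by (simp only: exact_on_kernel_def) (simp add: right_diff_distrib exp_minus)
    finally show ?thesis .
  qed
  have "(\<Sum>\<beta>=0..N. C \<beta> * ((exp (1 - ?x \<beta>) - 1) * D01 \<phi> 1 - \<phi> 1 + \<phi> (?x \<beta>)))
      = (\<Sum>\<beta>=0..N. C \<beta> * (exp (1 - ?x \<beta>) - 1)) * D01 \<phi> 1 - (\<Sum>\<beta>=0..N. C \<beta>) * \<phi> 1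
        + (\<Sum>\<beta>=0..N. C \<beta> * \<phi> (?x \<beta>))"
    unfolding sum_distrib_right sum_subtractf[symmetric] sum.distrib[symmetric]
    by (rule sum.cong) (auto simp: algebra_simps)
  also have "\<dots> = (exp 1 - 2) * D01 \<phi> 1 - \<phi> 1 + (\<Sum>\<beta>=0..N. C \<beta> * \<phi> (?x \<beta>))"
    using assms(2) by (simp only: e) (simp add: exact_on_kernel_def)
  finally have "((\<lambda>t. (exp t - 1 - t) * ?g t - (\<Sum>\<beta>=0..N. C \<beta> * (max 0 (exp (t - ?x \<beta>) - 1) * ?g t)))
      has_integral error_functional N C \<phi>) {0..1}"
    using has_integral_diff[OF 1 2] by (simp add: error_functional_def)
  then show ?thesis
    by (simp add: peano_kernel_def left_diff_distrib sum_distrib_right mult.assoc)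
qed

text \<open>All concrete test functions, including the extremal one, are of class C2 and enter
  \<open>W21\<close> through this lemma.\<close>

lemma W21_C2:
  assumes f: "\<And>x. x \<in> {0..1} \<Longrightarrow> (f has_real_derivative f1 x) (at x within {0..1})"
    and f1: "\<And>x. x \<in> {0..1} \<Longrightarrow> (f1 has_real_derivative f2 x) (at x within {0..1})"
    and f2: "continuous_on {0..1} f2"
  shows "f \<in> W21" "x \<in> {0..1} \<Longrightarrow> D01 f x = f1 x" "x \<in> {0..1} \<Longrightarrow> D01 (D01 f) x = f2 x"
    "W21_norm f = sqrt (integral {0..1} (\<lambda>x. (f2 x + f1 x)\<^sup>2))"
proof -
  show D1: "D01 f x = f1 x" if "x \<in> {0..1}" for x
    using D01_eqI f that by blast
  have D2': "(D01 f has_real_derivative f2 x) (at x within {0..1})" if "x \<in> {0..1}" for x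
    using has_field_derivative_transform_within[OF f1[OF that] zero_less_one that] D1 by auto
  then show D2: "D01 (D01 f) x = f2 x" if "x \<in> {0..1}" for x
    using D01_eqI that by blast
  have cont1: "continuous_on {0..1} f1" using f1 DERIV_continuous_on by blast
  have "abs_continuous_on {0..1} (D01 f)"
    using D2' f2 by (rule abs_continuous_on_C1)
  moreover have "f differentiable_on {0..1}"
    unfolding differentiable_on_def using f real_differentiable_def by blast
  moreover have "AE x in lebesgue_on {0..1}. D01 f differentiable (at x within {0..1})"
    using D2' by (intro AE_I2) (auto simp: real_differentiable_def simp del: atLeastAtMost_iff)
  moreover have "D01 (D01 f) \<in> borel_measurable (lebesgue_on {0..1})"
    using continuous_imp_measurable_on_sets_lebesgue[OF f2] D2
    by (subst measurable_cong[where g = f2]) auto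
  moreover have "integrable (lebesgue_on {0..1}) (\<lambda>x. (D01 (D01 f) x)\<^sup>2)"
  proof (subst Bochner_Integration.integrable_cong[OF refl])
    show "integrable (lebesgue_on {0..1}) (\<lambda>x. (f2 x)\<^sup>2)"
      using f2 by (intro continuous_imp_integrable_real continuous_intros)
  qed (auto simp: D2)
  ultimately show "f \<in> W21"
    by (simp add: W21_def square_integrable_on_def)
  have "W21_norm f = sqrt (LINT x|lebesgue_on {0..1}. (f2 x + f1 x)\<^sup>2)"
    unfolding W21_norm_def by (intro arg_cong[of _ _ sqrt] Bochner_Integration.integral_cong) (auto simp: D1 D2)
  also have "\<dots> = sqrt (integral {0..1} (\<lambda>x. (f2 x + f1 x)\<^sup>2))"
    by (subst lebesgue_integral_eq_integral)
       (auto intro!: continuous_imp_integrable_real continuous_intros cont1 f2)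
  finally show "W21_norm f = sqrt (integral {0..1} (\<lambda>x. (f2 x + f1 x)\<^sup>2))" .
qed

text \<open>A Bochner integral defaults to 0 for a non-integrable function, so integrability has to
  be established. It follows from (u + v)^2 <= 2 u^2 + 2 v^2, as \<open>D01 \<phi>\<close> is
  continuous and its derivative square integrable.\<close>

lemma W21_norm_has_integral:
  assumes "\<phi> \<in> W21"
  shows "((\<lambda>t. (D01 (D01 \<phi>) t + D01 \<phi> t)\<^sup>2) has_integral (W21_norm \<phi>)\<^sup>2) {0..1}"
proof -
  let ?M = "lebesgue_on {0..1::real}"
  have c: "continuous_on {0..1} (D01 \<phi>)"
    using W21_D01_abs_continuous[OF assms] by (rule abs_continuous_on_imp_continuous_on)
  have [measurable]: "D01 (D01 \<phi>) \<in> borel_measurable ?M"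
    using assms by (simp add: W21_def square_integrable_on_def)
  have [measurable]: "D01 \<phi> \<in> borel_measurable ?M"
    by (rule continuous_imp_measurable_on_sets_lebesgue[OF c]) auto
  have i2: "integrable ?M (\<lambda>t. (D01 (D01 \<phi>) t)\<^sup>2)"
    using assms by (simp add: W21_def square_integrable_on_def)
  have i: "integrable ?M (\<lambda>t. 2 * (D01 (D01 \<phi>) t)\<^sup>2 + 2 * (D01 \<phi> t)\<^sup>2)"
    by (intro Bochner_Integration.integrable_add integrable_mult_right i2 continuous_imp_integrable_real
        continuous_intros c)
  have int: "integrable ?M (\<lambda>t. (D01 (D01 \<phi>) t + D01 \<phi> t)\<^sup>2)"
  proof (rule Bochner_Integration.integrable_bound[OF i])
    show "AE x in ?M. norm ((D01 (D01 \<phi>) x + D01 \<phi> x)\<^sup>2)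
        \<le> norm (2 * (D01 (D01 \<phi>) x)\<^sup>2 + 2 * (D01 \<phi> x)\<^sup>2)"
    proof (rule AE_I2)
      fix x
      have "(D01 (D01 \<phi>) x + D01 \<phi> x)\<^sup>2 + (D01 (D01 \<phi>) x - D01 \<phi> x)\<^sup>2
          = 2 * (D01 (D01 \<phi>) x)\<^sup>2 + 2 * (D01 \<phi> x)\<^sup>2"
        by (simp add: power2_eq_square algebra_simps)
      then have "(D01 (D01 \<phi>) x + D01 \<phi> x)\<^sup>2 \<le> 2 * (D01 (D01 \<phi>) x)\<^sup>2 + 2 * (D01 \<phi> x)\<^sup>2"
        using zero_le_power2[of "D01 (D01 \<phi>) x - D01 \<phi> x"] by linarith
      then show "norm ((D01 (D01 \<phi>) x + D01 \<phi> x)\<^sup>2)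
        \<le> norm (2 * (D01 (D01 \<phi>) x)\<^sup>2 + 2 * (D01 \<phi> x)\<^sup>2)"
        by simp
    qed
  qed measurable
  have "(W21_norm \<phi>)\<^sup>2 = (LINT x|?M. (D01 (D01 \<phi>) x + D01 \<phi> x)\<^sup>2)"
    unfolding W21_norm_def by (simp add: Bochner_Integration.integral_nonneg)
  then show ?thesis
    using has_integral_integral_lebesgue_on[OF int] by simp
qed

section \<open>The dual norm as the L2 norm of the Peano kernel\<close>

lemma integrable_peano_kernel [intro]:
  "(\<lambda>t. peano_kernel N C t * peano_kernel N C' t) integrable_on {0..1}"
  by (intro integrable_continuous_interval continuous_intros)

text \<open>Cauchy-Schwarz, from the nonnegativity of the integral of the square of \<open>F - (\<integral>F g) g\<close>.\<close>

lemma error_functional_bound: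
  assumes "N \<ge> 1" "exact_on_kernel N C" "\<phi> \<in> W21" "W21_norm \<phi> = 1"
  shows "(error_functional N C \<phi>)\<^sup>2 \<le> integral {0..1} (\<lambda>t. (peano_kernel N C t)\<^sup>2)"
proof -
  define c where "c = error_functional N C \<phi>"
  let ?F = "peano_kernel N C" and ?g = "\<lambda>t. D01 (D01 \<phi>) t + D01 \<phi> t"
  have F: "((\<lambda>t. (?F t)\<^sup>2) has_integral integral {0..1} (\<lambda>t. (?F t)\<^sup>2)) {0..1}"
    using integrable_peano_kernel[of N C C] by (simp add: power2_eq_square integrable_integral)
  have "((\<lambda>t. ((?F t)\<^sup>2 - 2 * c * (?F t * ?g t)) + c\<^sup>2 * (?g t)\<^sup>2) has_integral
      (integral {0..1} (\<lambda>t. (?F t)\<^sup>2) - 2 * c * c) + c\<^sup>2 * (W21_norm \<phi>)\<^sup>2) {0..1}"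
    using assms unfolding c_def
    by (intro has_integral_add has_integral_diff has_integral_mult_right F
        has_integral_peano_kernel W21_norm_has_integral)
  moreover have "(?F t)\<^sup>2 - 2 * c * (?F t * ?g t) + c\<^sup>2 * (?g t)\<^sup>2 = (?F t - c * ?g t)\<^sup>2" for t
    by (simp add: power2_eq_square algebra_simps)
  ultimately have "((\<lambda>t. (?F t - c * ?g t)\<^sup>2) has_integral
      integral {0..1} (\<lambda>t. (?F t)\<^sup>2) - c\<^sup>2) {0..1}"
    using assms(4) by (simp add: power2_eq_square algebra_simps)
  then have "0 \<le> integral {0..1} (\<lambda>t. (?F t)\<^sup>2) - c\<^sup>2"
    by (rule has_integral_nonneg) simp
  then show ?thesis by (simp add: c_def)
qed

lemma W21_dual_norm_le:
  assumes "N \<ge> 1" "exact_on_kernel N C"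
  shows "W21_dual_norm (error_functional N C)
    \<le> ereal (sqrt (integral {0..1} (\<lambda>t. (peano_kernel N C t)\<^sup>2)))"
  unfolding W21_dual_norm_def
  using error_functional_bound[OF assms] by (intro SUP_least) (auto intro!: real_le_rsqrt)

lemma le_W21_dual_norm:
  "\<phi> \<in> W21 \<Longrightarrow> W21_norm \<phi> = 1 \<Longrightarrow> ereal \<bar>L \<phi>\<bar> \<le> W21_dual_norm L"
  unfolding W21_dual_norm_def by (intro SUP_upper) auto

text \<open>Moving along the kernel of the seminorm away from \<open>x\<close> keeps the norm at 1.
  These functions detect a lack of exactness and show that the supremum runs over a nonempty
  set.\<close>

lemma W21_affine_plus_exp:
  "(\<lambda>x. x + a + b * exp (- x)) \<in> W21" "W21_norm (\<lambda>x. x + a + b * exp (- x)) = 1"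
proof -
  have 1: "((\<lambda>x. x + a + b * exp (- x)) has_real_derivative 1 - b * exp (- x)) (at x within {0..1})" for x
    by (auto intro!: derivative_eq_intros)
  have 2: "((\<lambda>x. 1 - b * exp (- x)) has_real_derivative b * exp (- x)) (at x within {0..1})" for x
    by (auto intro!: derivative_eq_intros)
  have 3: "continuous_on {0..1} (\<lambda>x. b * exp (- x))" by (intro continuous_intros)
  show "(\<lambda>x. x + a + b * exp (- x)) \<in> W21" using W21_C2(1)[OF 1 2 3] .
  show "W21_norm (\<lambda>x. x + a + b * exp (- x)) = 1" using W21_C2(4)[OF 1 2 3] by simp
qed

text \<open>The bound is attained: for \<open>s > 0\<close> the solution of \<psi>'' + \<psi>' = F /
  s has norm 1 and error \<open>s\<close>, where F is the Peano kernel and \<open>s\<close> its L2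
  norm.\<close>

lemma W21_dual_norm_ge:
  assumes "N \<ge> 1" "exact_on_kernel N C"
  shows "ereal (sqrt (integral {0..1} (\<lambda>t. (peano_kernel N C t)\<^sup>2)))
    \<le> W21_dual_norm (error_functional N C)"
proof -
  let ?F = "peano_kernel N C"
  define s where "s = sqrt (integral {0..1} (\<lambda>t. (?F t)\<^sup>2))"
  have s2: "s\<^sup>2 = integral {0..1} (\<lambda>t. (?F t)\<^sup>2)"
    unfolding s_def
    by (intro real_sqrt_pow2 integral_nonneg)
       (use integrable_peano_kernel[of N C C] in \<open>auto simp: power2_eq_square\<close>)
  have "s \<ge> 0"
    unfolding s_def
    by (intro real_sqrt_ge_zero integral_nonneg)
       (use integrable_peano_kernel[of N C C] in \<open>auto simp: power2_eq_square\<close>)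
  show ?thesis
  proof (cases "s = 0")
    case True
    \<comment> \<open>Normalising by \<open>s\<close> is impossible here. One admissible function
      suffices; it rules out the value minus infinity of an empty supremum.\<close>
    have "ereal 0 \<le> ereal \<bar>error_functional N C (\<lambda>x. x + 0 + 0 * exp (- x))\<bar>" by simp
    also have "\<dots> \<le> W21_dual_norm (error_functional N C)"
      by (intro le_W21_dual_norm W21_affine_plus_exp)
    finally show ?thesis using True by (simp add: s_def)
  next
    case False
    with \<open>s \<ge> 0\<close> have "s > 0" by simp
    define g where "g t = ?F t / s" for t
    \<comment> \<open>Variation of constants: \<open>P\<close> solves P' + P = g and will be the
      derivative of \<open>\<psi>\<close>.\<close>
    define P where "P x = exp (- x) * integral {0..x} (\<lambda>t. exp t * g t)" for x
    define \<psi> where "\<psi> x = integral {0..x} P" for x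
    have g: "continuous_on {0..1} g" unfolding g_def using \<open>s > 0\<close> by (intro continuous_intros) auto
    have P: "(P has_real_derivative g x - P x) (at x within {0..1})" if "x \<in> {0..1}" for x
    proof -
      have "((\<lambda>x. integral {0..x} (\<lambda>t. exp t * g t)) has_real_derivative exp x * g x) (at x within {0..1})"
        by (rule integral_has_real_derivative) (use g that in \<open>auto intro!: continuous_intros\<close>)
      moreover have "((\<lambda>x. exp (- x)) has_real_derivative - exp (- x)) (at x within {0..1})"
        by (auto intro!: derivative_eq_intros)
      ultimately have "(P has_real_derivative
          (- exp (- x)) * integral {0..x} (\<lambda>t. exp t * g t) + (exp x * g x) * exp (- x)) (at x within {0..1})"
        unfolding P_def by (intro DERIV_mult)
      moreover have "(- exp (- x)) * integral {0..x} (\<lambda>t. exp t * g t) + (exp x * g x) * exp (- x) = g x - P x"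
        by (simp add: P_def exp_minus)
      ultimately show ?thesis by (simp only:)
    qed
    then have Pc: "continuous_on {0..1} P" by (rule DERIV_continuous_on)
    have \<psi>: "(\<psi> has_real_derivative P x) (at x within {0..1})" if "x \<in> {0..1}" for x
      unfolding \<psi>_def using integral_has_real_derivative[OF Pc that] .
    have gPc: "continuous_on {0..1} (\<lambda>x. g x - P x)" using g Pc by (intro continuous_intros)
    have \<psi>_W21: "\<psi> \<in> W21"
      and D: "\<And>x. x \<in> {0..1} \<Longrightarrow> D01 \<psi> x = P x" "\<And>x. x \<in> {0..1} \<Longrightarrow> D01 (D01 \<psi>) x = g x - P x"
      and n_eq: "W21_norm \<psi> = sqrt (integral {0..1} (\<lambda>x. (g x - P x + P x)\<^sup>2))"
      using W21_C2[of \<psi> P "\<lambda>x. g x - P x", OF \<psi> P gPc] by blast+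
    have "W21_norm \<psi> = sqrt (integral {0..1} (\<lambda>t. (?F t)\<^sup>2 / s\<^sup>2))"
      by (simp add: n_eq g_def power_divide)
    also have "\<dots> = 1" using \<open>s > 0\<close> by (simp add: s2[symmetric])
    finally have n: "W21_norm \<psi> = 1" .
    have "((\<lambda>t. ?F t * (D01 (D01 \<psi>) t + D01 \<psi> t)) has_integral error_functional N C \<psi>) {0..1}"
      by (rule has_integral_peano_kernel[OF assms \<psi>_W21])
    then have "((\<lambda>t. (?F t)\<^sup>2 / s) has_integral error_functional N C \<psi>) {0..1}"
      by (subst (asm) has_integral_cong[where g = "\<lambda>t. (?F t)\<^sup>2 / s"])
         (auto simp: D g_def power2_eq_square)
    then have "error_functional N C \<psi> = integral {0..1} (\<lambda>t. (?F t)\<^sup>2 / s)"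
      by (rule integral_unique[symmetric])
    also have "\<dots> = s" using \<open>s > 0\<close> s2[symmetric] by (simp add: power2_eq_square)
    finally show ?thesis
      using le_W21_dual_norm[OF \<psi>_W21 n, of "error_functional N C"] \<open>s > 0\<close> by (simp add: s_def)
  qed
qed

text \<open>On the functions \<open>x + a + b * exp (- x)\<close>, all of norm 1, the error is
  affine in \<open>a\<close> and \<open>b\<close>, with the defects \<open>p\<close> and
  \<open>q\<close> of exactness as slopes. If one of them is nonzero, every real value is
  taken.\<close>

lemma W21_dual_norm_not_exact:
  assumes "N \<ge> 1" "\<not> exact_on_kernel N C"
  shows "W21_dual_norm (error_functional N C) = \<infinity>"
proof -
  define f where "f a b = (\<lambda>x::real. x + a + b * exp (- x))" for a b
  define A where "A = error_functional N C (f 0 0)"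
  define p where "p = 1 - (\<Sum>\<beta>=0..N. C \<beta>)"
  define q where "q = 1 - exp (- 1) - (\<Sum>\<beta>=0..N. C \<beta> * exp (- (1 / real N * real \<beta>)))"
  have e: "error_functional N C (f a b) = A + a * p + b * q" for a b
  proof -
    have i: "((\<lambda>x. x + a + b * exp (- x)) has_integral
        (1\<^sup>2 / 2 + a * 1 - b * exp (- 1)) - (0\<^sup>2 / 2 + a * 0 - b * exp (- 0))) {0..1}" for a b :: real
      by (rule fundamental_theorem_of_calculus)
         (auto intro!: derivative_eq_intros simp flip: has_real_derivative_iff_has_vector_derivative)
    show ?thesis
      unfolding A_def error_functional_def f_def p_def q_def integral_unique[OF i]
      by (simp add: algebra_simps sum.distrib sum_distrib_left)
  qed
  have bound: "ereal \<bar>A + a * p + b * q\<bar> \<le> W21_dual_norm (error_functional N C)" for a b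
    unfolding e[symmetric] f_def by (intro le_W21_dual_norm W21_affine_plus_exp)
  have "p \<noteq> 0 \<or> q \<noteq> 0" using assms(2) by (auto simp: exact_on_kernel_def p_def q_def)
  then have "ereal r \<le> W21_dual_norm (error_functional N C)" for r
  proof
    assume "p \<noteq> 0"
    have "ereal r \<le> ereal \<bar>A + ((r - A) / p) * p + 0 * q\<bar>" using \<open>p \<noteq> 0\<close> by simp
    also note bound
    finally show ?thesis .
  next
    assume "q \<noteq> 0"
    have "ereal r \<le> ereal \<bar>A + 0 * p + ((r - A) / q) * q\<bar>" using \<open>q \<noteq> 0\<close> by simp
    also note bound
    finally show ?thesis .
  qed
  then show ?thesis by (rule ereal_top)
qed

text \<open>Least squares by Pythagoras: orthogonality splits the squared norm for \<open>C\<close>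
  into that for \<open>Cs\<close> plus the squared distance \<open>D C\<close> of the kernels.
  Inexact coefficients have infinite norm and cannot compete. Equality forces
  \<open>D C = 0\<close>, hence equal kernels by continuity, hence equal coefficients by
  \<open>inj\<close>.\<close>

lemma optimal_coefficients_iff:
  assumes N: "N \<ge> 1" and Cs: "exact_on_kernel N Cs"
    and orth: "\<And>C. exact_on_kernel N C \<Longrightarrow>
      integral {0..1} (\<lambda>t. peano_kernel N Cs t * (peano_kernel N C t - peano_kernel N Cs t)) = 0"
    and inj: "\<And>C. exact_on_kernel N C \<Longrightarrow> (\<And>t. t \<in> {0..1} \<Longrightarrow> peano_kernel N C t = peano_kernel N Cs t) \<Longrightarrow>
      \<forall>\<beta>\<le>N. C \<beta> = Cs \<beta>"
  shows "optimal_coefficients N C \<longleftrightarrow> (\<forall>\<beta>\<le>N. C \<beta> = Cs \<beta>)"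
proof -
  define I where "I C = integral {0..1} (\<lambda>t. (peano_kernel N C t)\<^sup>2)" for C
  define D where "D C = integral {0..1} (\<lambda>t. (peano_kernel N C t - peano_kernel N Cs t)\<^sup>2)" for C
  define n where "n C = W21_dual_norm (error_functional N C)" for C
  have n: "n C = ereal (sqrt (I C))" if "exact_on_kernel N C" for C
    unfolding n_def I_def
    using W21_dual_norm_le[OF N that] W21_dual_norm_ge[OF N that] by (rule antisym)
  have pyth: "I C = I Cs + D C" if "exact_on_kernel N C" for C
  proof -
    let ?F = "peano_kernel N Cs" and ?G = "\<lambda>t. peano_kernel N C t - peano_kernel N Cs t"
    have 1: "((\<lambda>t. (?F t)\<^sup>2) has_integral I Cs) {0..1}" "((\<lambda>t. (?G t)\<^sup>2) has_integral D C) {0..1}"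
      unfolding I_def D_def by (intro integrable_integral integrable_continuous_interval continuous_intros)+
    have 2: "((\<lambda>t. ?F t * ?G t) has_integral 0) {0..1}"
      unfolding has_integral_integrable_integral
      by (intro conjI orth[OF that] integrable_continuous_interval continuous_intros)
    have "((\<lambda>t. ((?F t)\<^sup>2 + 2 * (?F t * ?G t)) + (?G t)\<^sup>2) has_integral (I Cs + 2 * 0) + D C) {0..1}"
      by (intro has_integral_add has_integral_mult_right 1 2)
    moreover have "((?F t)\<^sup>2 + 2 * (?F t * ?G t)) + (?G t)\<^sup>2 = (peano_kernel N C t)\<^sup>2" for t
      by (simp add: power2_eq_square algebra_simps)
    ultimately show ?thesis by (simp add: I_def integral_unique)
  qed
  have D0: "D C \<ge> 0" for C
    unfolding D_def by (intro integral_nonneg integrable_continuous_interval continuous_intros) auto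
  have "n Cs \<le> n C" for C
  proof (cases "exact_on_kernel N C")
    case True
    then show ?thesis using pyth[OF True] D0[of C] by (simp add: n Cs)
  next
    case False
    then show ?thesis using W21_dual_norm_not_exact[OF N] by (simp add: n_def)
  qed
  then have inf: "(INF C. n C) = n Cs"
    by (intro antisym INF_lower INF_greatest) auto
  show ?thesis
  proof
    assume "optimal_coefficients N C"
    then have nC: "n C = n Cs" using inf by (simp add: optimal_coefficients_def n_def)
    then have ex: "exact_on_kernel N C"
      using W21_dual_norm_not_exact[OF N, of C] n[OF Cs] by (auto simp: n_def)
    with nC have "D C = 0" using pyth[OF ex] n[OF ex] n[OF Cs] by simp
    moreover have "D C = 0 \<longleftrightarrow> (\<forall>t\<in>{0..1}. (peano_kernel N C t - peano_kernel N Cs t)\<^sup>2 = 0)"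
      unfolding D_def by (rule integral_eq_0_iff) (auto intro!: continuous_intros)
    ultimately have "(peano_kernel N C t - peano_kernel N Cs t)\<^sup>2 = 0" if "t \<in> {0..1}" for t
      using that by blast
    then show "\<forall>\<beta>\<le>N. C \<beta> = Cs \<beta>" using inj[OF ex] by simp
  next
    assume "\<forall>\<beta>\<le>N. C \<beta> = Cs \<beta>"
    then have "error_functional N C = error_functional N Cs"
      by (auto simp: error_functional_def fun_eq_iff)
    then show "optimal_coefficients N C" using inf by (simp add: optimal_coefficients_def n_def)
  qed
qed

subsection \<open>Splines on equidistant nodes\<close>

locale equidistant_nodes =
  fixes N :: nat and h :: real
  assumes N: "N \<ge> 1" and h: "h = 1 / real N"
begin

lemma step_pos: "h > 0" "exp h > 1" "h * real N = 1"
  using N by (auto simp: h)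

text \<open>Between the nodes \<open>k\<close> and \<open>k + 1\<close> the kernel is \<open>-t + A exp t + B\<close> with \<open>A = exp (-hk)\<close> times this slope.\<close>

definition kernel_slope :: "(nat \<Rightarrow> real) \<Rightarrow> nat \<Rightarrow> real" where
  "kernel_slope C k = exp (h * real k) * (1 - (\<Sum>\<beta>=0..k. C \<beta> * exp (- (h * real \<beta>))))"

lemma kernel_slope_0: "kernel_slope C 0 = 1 - C 0"
  by (simp add: kernel_slope_def)

text \<open>Read backwards, this recovers a coefficient from two consecutive slopes.\<close>

lemma kernel_slope_Suc: "kernel_slope C (Suc k) = exp h * kernel_slope C k - C (Suc k)"
proof -
  have "exp (h * real (Suc k)) * exp (- (h * real (Suc k))) = 1"
    by (simp add: exp_minus)
  moreover have "exp (h * real (Suc k)) = exp h * exp (h * real k)"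
    by (simp add: distrib_left exp_add)
  ultimately show ?thesis
    by (simp add: kernel_slope_def algebra_simps)
qed

text \<open>On this piece the truncation removes exactly the nodes beyond \<open>k\<close>.
  Comparing the remaining expression at \<open>s\<close> and at 0 eliminates its constant
  part.\<close>

lemma peano_kernel_between_nodes:
  assumes "k < N" "0 \<le> s" "s \<le> h"
  shows "peano_kernel N C (h * real k + s) + s = peano_kernel N C (h * real k) + kernel_slope C k * (exp s - 1)"
proof -
  have *: "peano_kernel N C (h * real k + s) = exp (h * real k + s) - 1 - (h * real k + s)
      - (\<Sum>\<beta>=0..k. C \<beta> * (exp (h * real k + s - h * real \<beta>) - 1))" if "0 \<le> s" "s \<le> h" for s
  proof -
    have "(\<Sum>\<beta>=0..N. C \<beta> * max 0 (exp (h * real k + s - h * real \<beta>) - 1))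
        = (\<Sum>\<beta>=0..k. C \<beta> * (exp (h * real k + s - h * real \<beta>) - 1))"
    proof (rule sum.mono_neutral_cong_right)
      show "\<forall>\<beta>\<in>{0..N} - {0..k}. C \<beta> * max 0 (exp (h * real k + s - h * real \<beta>) - 1) = 0"
      proof
        fix \<beta> assume "\<beta> \<in> {0..N} - {0..k}"
        then have "h * (real k + 1) \<le> h * real \<beta>" using step_pos by (intro mult_left_mono) auto
        then have "h * real k + s - h * real \<beta> \<le> 0" using that by (simp add: algebra_simps)
        then show "C \<beta> * max 0 (exp (h * real k + s - h * real \<beta>) - 1) = 0" by (simp add: max_def)
      qed
    next
      fix \<beta> assume "\<beta> \<in> {0..k}"
      then have "h * real \<beta> \<le> h * real k" using step_pos by (intro mult_left_mono) auto
      then have "0 \<le> h * real k + s - h * real \<beta>" using that by linarith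
      then show "C \<beta> * max 0 (exp (h * real k + s - h * real \<beta>) - 1)
          = C \<beta> * (exp (h * real k + s - h * real \<beta>) - 1)" by (simp add: max_def)
    qed (use \<open>k < N\<close> in auto)
    then show ?thesis by (simp add: peano_kernel_def h)
  qed
  have "(\<Sum>\<beta>=0..k. C \<beta> * (exp (h * real k + s - h * real \<beta>) - 1))
      = exp s * exp (h * real k) * (\<Sum>\<beta>=0..k. C \<beta> * exp (- (h * real \<beta>))) - (\<Sum>\<beta>=0..k. C \<beta>)" for s
    by (simp add: sum_distrib_left sum_subtractf[symmetric] exp_add exp_diff exp_minus algebra_simps divide_inverse)
  from this[of s] this[of 0] show ?thesis
    using *[OF assms(2,3)] *[of 0] step_pos(1)
    by (simp add: kernel_slope_def exp_add algebra_simps)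
qed

lemma peano_kernel_0: "peano_kernel N C 0 = 0"
proof -
  have "(\<Sum>\<beta>=0..N. C \<beta> * max 0 (exp (0 - 1 / real N * real \<beta>) - 1)) = 0"
    by (intro sum.neutral) (auto simp: max_def divide_le_0_iff)
  then show ?thesis by (simp add: peano_kernel_def)
qed

lemma peano_kernel_Suc_node:
  assumes "k < N"
  shows "peano_kernel N C (h * real (Suc k)) + h = peano_kernel N C (h * real k) + kernel_slope C k * (exp h - 1)"
  using peano_kernel_between_nodes[OF assms, of h C] step_pos(1) by (simp add: algebra_simps)

text \<open>Exactness becomes an end condition on the spline: value and right derivative vanish at
  1, the latter being \<open>kernel_slope C N - 1\<close>.\<close>

lemma exact_on_kernel_iff:
  "exact_on_kernel N C \<longleftrightarrow> kernel_slope C N = 1 \<and> peano_kernel N C 1 = 0"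
proof -
  define P where "P = (\<Sum>\<beta>=0..N. C \<beta>)"
  define Q where "Q = (\<Sum>\<beta>=0..N. C \<beta> * exp (- (h * real \<beta>)))"
  have "(\<Sum>\<beta>=0..N. C \<beta> * max 0 (exp (1 - h * real \<beta>) - 1)) = (\<Sum>\<beta>=0..N. C \<beta> * (exp (1 - h * real \<beta>) - 1))"
  proof (rule sum.cong[OF refl])
    fix \<beta> assume "\<beta> \<in> {0..N}"
    then have "h * real \<beta> \<le> h * real N" using step_pos by (intro mult_left_mono) auto
    then have "h * real \<beta> \<le> 1" using step_pos by simp
    then show "C \<beta> * max 0 (exp (1 - h * real \<beta>) - 1) = C \<beta> * (exp (1 - h * real \<beta>) - 1)"
      by (simp add: max_def)
  qed
  also have "\<dots> = exp 1 * Q - P"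
    by (simp add: P_def Q_def sum_distrib_left sum_subtractf[symmetric] exp_diff exp_minus algebra_simps divide_inverse)
  finally have F: "peano_kernel N C 1 = exp 1 - 2 - exp 1 * Q + P"
    by (simp add: peano_kernel_def h)
  have S: "kernel_slope C N = exp 1 * (1 - Q)"
    using step_pos(3) by (simp add: kernel_slope_def Q_def)
  have Q: "Q = 1 - exp (- 1) \<longleftrightarrow> exp 1 * Q = exp 1 - 1"
  proof -
    have "exp 1 * (1 - exp (- 1)) = exp 1 - (1::real)" by (simp add: exp_minus right_diff_distrib)
    then show ?thesis by (metis exp_not_eq_zero mult_cancel_left)
  qed
  have "exact_on_kernel N C \<longleftrightarrow> P = 1 \<and> Q = 1 - exp (- 1)"
    by (simp add: exact_on_kernel_def P_def Q_def h)
  then show ?thesis unfolding Q F S by (auto simp: algebra_simps)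
qed

text \<open>The nodal values determine the slopes before the last node, exactness fixes the slope at
  \<open>N\<close> to be 1, and the slopes determine the coefficients.\<close>

lemma coefficients_eq_of_peano_kernel_eq:
  assumes "exact_on_kernel N C" "exact_on_kernel N C'"
    and "\<And>t. t \<in> {0..1} \<Longrightarrow> peano_kernel N C t = peano_kernel N C' t"
  shows "\<forall>\<beta>\<le>N. C \<beta> = C' \<beta>"
proof -
  have p: "peano_kernel N C (h * real k) = peano_kernel N C' (h * real k)" if "k \<le> N" for k
  proof (rule assms(3))
    have "h * real k \<le> h * real N" using that step_pos by (intro mult_left_mono) auto
    then show "h * real k \<in> {0..1}" using step_pos by simp
  qed
  have a: "kernel_slope C k = kernel_slope C' k" if "k \<le> N" for k
  proof (cases "k = N")
    case True
    then show ?thesis using assms(1,2) by (simp add: exact_on_kernel_iff)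
  next
    case False
    then have "k < N" using that by simp
    then have "kernel_slope C k * (exp h - 1) = kernel_slope C' k * (exp h - 1)"
      using peano_kernel_Suc_node[of k C] peano_kernel_Suc_node[of k C'] p[of k] p[of "Suc k"]
      by (simp only: less_imp_le[OF \<open>k < N\<close>] Suc_leI[OF \<open>k < N\<close>] \<open>k < N\<close> simp_thms) linarith
    then show ?thesis using step_pos by simp
  qed
  show ?thesis
  proof (intro allI impI)
    fix \<beta> assume "\<beta> \<le> N"
    then show "C \<beta> = C' \<beta>"
      using a[of \<beta>] a[of "\<beta> - 1"] by (cases \<beta>) (auto simp: kernel_slope_0 kernel_slope_Suc)
  qed
qed

section \<open>Interpolation by exponential hat functions and orthogonality\<close>

definition hat :: "real \<Rightarrow> real" where "hat s = (exp s - 1) / (exp h - 1)"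

text \<open>Since \<open>hat\<close> rises from 0 at 0 to 1 at \<open>h\<close>, the slope can be
  replaced by nodal values. In the difference of two kernels the terms \<open>h\<close> and
  \<open>- s\<close> cancel, leaving pure interpolation by \<open>1 - hat\<close> and
  \<open>hat\<close>.\<close>

lemma peano_kernel_interpolation:
  assumes "k < N" "0 \<le> s" "s \<le> h"
  shows "peano_kernel N C (h * real k + s) = peano_kernel N C (h * real k)
    + (peano_kernel N C (h * real (Suc k)) - peano_kernel N C (h * real k) + h) * hat s - s"
proof -
  have "kernel_slope C k * (exp s - 1) = kernel_slope C k * (exp h - 1) * hat s"
    using step_pos by (simp add: hat_def)
  also have "kernel_slope C k * (exp h - 1) =
      peano_kernel N C (h * real (Suc k)) - peano_kernel N C (h * real k) + h"
    using peano_kernel_Suc_node[OF assms(1), of C] by linarith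
  finally show ?thesis
    using peano_kernel_between_nodes[OF assms, of C] by linarith
qed

lemma has_integral_pieces:
  fixes f :: "real \<Rightarrow> real"
  assumes "\<And>k. k < n \<Longrightarrow> ((\<lambda>s. f (h * real k + s)) has_integral I k) {0..h}"
  shows "(f has_integral (\<Sum>k<n. I k)) {0..h * real n}"
  using assms
proof (induction n)
  case 0
  show ?case using has_integral_refl(2)[of f 0] by simp
next
  case (Suc n)
  have "((\<lambda>s. f (h * real n + s)) has_integral I n) (cbox 0 h)" using Suc.prems[of n] by simp
  from has_integral_affinity[OF this, of 1 "- (h * real n)"]
  have "(f has_integral I n) {h * real n..h * real (Suc n)}"
    using step_pos(1) by (simp add: algebra_simps)
  moreover have "(f has_integral (\<Sum>k<n. I k)) {0..h * real n}"
    using Suc by simp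
  ultimately show ?case
    using has_integral_combine[of 0 "h * real n" "h * real (Suc n)" f] step_pos(1) by simp
qed

text \<open>The integrals of \<open>hat\<close> and of its square over one cell.\<close>

definition "hat1 = (exp h - 1 - h) / (exp h - 1)"
definition "hat2 = ((exp h ^ 2 - 1) / 2 - 2 * (exp h - 1) + h) / (exp h - 1)\<^sup>2"

lemma has_integral_hat: "(hat has_integral hat1) {0..h}"
proof -
  have "((\<lambda>s. exp s - 1) has_integral (exp h - h) - (exp 0 - 0)) {0..h}"
    using step_pos
    by (intro fundamental_theorem_of_calculus)
       (auto intro!: derivative_eq_intros simp flip: has_real_derivative_iff_has_vector_derivative)
  then have "((\<lambda>s. exp s - 1) has_integral exp h - 1 - h) {0..h}" by (simp add: algebra_simps)
  then show ?thesis unfolding hat_def hat1_def by (rule has_integral_divide)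
qed

lemma has_integral_hat_power2: "((\<lambda>s. (hat s)\<^sup>2) has_integral hat2) {0..h}"
proof -
  have "((\<lambda>s. (exp s - 1)\<^sup>2) has_integral (exp h ^ 2 / 2 - 2 * exp h + h)
      - (exp 0 ^ 2 / 2 - 2 * exp 0 + 0)) {0..h}"
    using step_pos
    by (intro fundamental_theorem_of_calculus)
       (auto intro!: derivative_eq_intros simp: power2_eq_square algebra_simps
         simp flip: has_real_derivative_iff_has_vector_derivative)
  then have "((\<lambda>s. (exp s - 1)\<^sup>2) has_integral (exp h ^ 2 - 1) / 2 - 2 * (exp h - 1) + h) {0..h}"
    by (simp add: algebra_simps diff_divide_distrib)
  then show ?thesis unfolding hat_def hat2_def power_divide by (rule has_integral_divide)
qed

text \<open>Regrouped by \<open>q\<close>, the interior value \<open>q (Suc k)\<close> carries the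
  factor \<open>X (Suc k) + Y k\<close>, so only the two end terms survive.\<close>

lemma sum_telescoping_pairs:
  fixes q X Y :: "nat \<Rightarrow> real"
  assumes "\<And>k. Suc k < n \<Longrightarrow> X (Suc k) + Y k = 0"
  shows "n \<ge> 1 \<Longrightarrow> (\<Sum>k<n. q k * X k + q (Suc k) * Y k) = q 0 * X 0 + q n * Y (n - 1)"
  using assms
proof (induction n)
  case (Suc n)
  show ?case
  proof (cases n)
    case (Suc m)
    have "X n + Y m = 0" using Suc.prems(2)[of m] Suc by simp
    then have "q n * X n + q n * Y m = 0" by (simp flip: distrib_left)
    then show ?thesis using Suc.IH Suc.prems(2) Suc by simp
  qed simp
qed simp

text \<open>
  Testing against a function with nodal values \<open>q\<close> produces the three-term recurrence at each
  interior node; the boundary terms vanish because \<open>q\<close> does at \<open>0\<close> and \<open>1\<close>.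
\<close>

lemma peano_kernel_orthogonal:
  assumes rec: "\<And>k. Suc k < N \<Longrightarrow>
      (hat1 - hat2) * (peano_kernel N C (h * real k) + peano_kernel N C (h * real (Suc (Suc k))))
      + (h - 2 * (hat1 - hat2)) * peano_kernel N C (h * real (Suc k)) + (h * hat1 - h\<^sup>2 / 2) = 0"
    and "peano_kernel N C 1 = 0" "peano_kernel N C' 1 = 0"
  shows "integral {0..1} (\<lambda>t. peano_kernel N C t * (peano_kernel N C' t - peano_kernel N C t)) = 0"
proof -
  define f where "f k = peano_kernel N C (h * real k)" for k
  define q where "q k = peano_kernel N C' (h * real k) - peano_kernel N C (h * real k)" for k
  let ?H = "\<lambda>t. peano_kernel N C t * (peano_kernel N C' t - peano_kernel N C t)"
  \<comment> \<open>No closed form is required: \<open>S\<close> cancels in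
    \<open>X (Suc k) + Y k\<close>.\<close>
  define S where "S = integral {0..h} (\<lambda>s. s * hat s)"
  have S: "((\<lambda>s. s * hat s) has_integral S) {0..h}"
    unfolding S_def hat_def using step_pos
    by (intro integrable_integral integrable_continuous_interval continuous_intros) auto
  have id: "((\<lambda>s. s) has_integral h\<^sup>2 / 2) {0..h}"
    using ident_has_integral[of 0 h] step_pos(1) by simp
  have one: "((\<lambda>s. 1) has_integral h) {0..h}"
    using has_integral_const_real[of "1::real" 0 h] step_pos(1) by simp
  \<comment> \<open>\<open>X k\<close> and \<open>Y k\<close> are the integrals of the kernel over
    the cell \<open>k\<close> against \<open>1 - hat\<close> and against \<open>hat\<close>.\<close>
  define X where "X k = f k * (h - 2 * hat1 + hat2) + f (Suc k) * (hat1 - hat2) + (h * hat1 - h\<^sup>2 / 2 - (h * hat2 - S))" for k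
  define Y where "Y k = f k * (hat1 - hat2) + f (Suc k) * hat2 + (h * hat2 - S)" for k
  have "((\<lambda>s. ?H (h * real k + s)) has_integral q k * X k + q (Suc k) * Y k) {0..h}" if "k < N" for k
  proof -
    define \<alpha> \<beta> \<gamma> \<delta> where "\<alpha> = f k" "\<beta> = f (Suc k) - f k + h" "\<gamma> = q k" "\<delta> = q (Suc k) - q k"
    note defs = this
    have int: "((\<lambda>s. \<alpha> * \<gamma> * 1 + (\<alpha> * \<delta> + \<beta> * \<gamma>) * hat s + \<beta> * \<delta> * (hat s)\<^sup>2 - \<gamma> * s - \<delta> * (s * hat s)) has_integral
        \<alpha> * \<gamma> * h + (\<alpha> * \<delta> + \<beta> * \<gamma>) * hat1 + \<beta> * \<delta> * hat2 - \<gamma> * (h\<^sup>2 / 2) - \<delta> * S) {0..h}"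
      by (intro has_integral_add has_integral_diff has_integral_mult_right one id S has_integral_hat
          has_integral_hat_power2)
    have eq: "?H (h * real k + s) = \<alpha> * \<gamma> * 1 + (\<alpha> * \<delta> + \<beta> * \<gamma>) * hat s + \<beta> * \<delta> * (hat s)\<^sup>2 - \<gamma> * s - \<delta> * (s * hat s)"
      if "s \<in> {0..h}" for s
    proof -
      have "peano_kernel N C (h * real k + s) = \<alpha> + \<beta> * hat s - s"
        "peano_kernel N C' (h * real k + s) - peano_kernel N C (h * real k + s) = \<gamma> + \<delta> * hat s"
        using peano_kernel_interpolation[OF \<open>k < N\<close>, where s = s and C = C]
          peano_kernel_interpolation[OF \<open>k < N\<close>, where s = s and C = C'] that
        unfolding defs f_def q_def by (simp_all add: algebra_simps)
      then have "?H (h * real k + s) = (\<alpha> + \<beta> * hat s - s) * (\<gamma> + \<delta> * hat s)"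
        by (rule arg_cong2[where f = "(*)"])
      then show ?thesis by (simp add: power2_eq_square algebra_simps)
    qed
    have val: "\<alpha> * \<gamma> * h + (\<alpha> * \<delta> + \<beta> * \<gamma>) * hat1 + \<beta> * \<delta> * hat2 - \<gamma> * (h\<^sup>2 / 2) - \<delta> * S
        = q k * X k + q (Suc k) * Y k"
      unfolding defs X_def Y_def by (simp add: algebra_simps)
    show ?thesis using has_integral_eq[OF eq[symmetric] int] by (simp only: val)
  qed
  then have "(?H has_integral (\<Sum>k<N. q k * X k + q (Suc k) * Y k)) {0..h * real N}"
    by (rule has_integral_pieces)
  moreover have "(\<Sum>k<N. q k * X k + q (Suc k) * Y k) = q 0 * X 0 + q N * Y (N - 1)"
  proof (rule sum_telescoping_pairs[OF _ N])
    fix k assume "Suc k < N"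
    then show "X (Suc k) + Y k = 0"
      using rec[of k] unfolding X_def Y_def f_def[symmetric] by (simp add: algebra_simps)
  qed
  moreover have "q 0 = 0" "q N = 0"
    using assms(2,3) step_pos(3) by (simp_all add: q_def peano_kernel_0)
  ultimately show ?thesis using step_pos(3) by (simp add: integral_unique)
qed

subsection \<open>The optimal kernel\<close>

text \<open>These fix the signs in the quadratic equation for \<open>lambda1 h\<close>. Both are
  monotonicity arguments from the value 0 at \<open>h = 0\<close>; the first is divided by
  \<open>exp h\<close> beforehand, which gives the derivative
  \<open>(exp x - 1)\<^sup>2 / exp x\<close>.\<close>

lemma step_bounds: "exp h ^ 2 - 1 - 2 * h * exp h > 0" "h * (exp h + 1) - 2 * (exp h - 1) > 0"
proof -
  have "exp 0 - exp (- 0) - 2 * 0 < exp h - exp (- h) - 2 * h"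
  proof (rule DERIV_pos_imp_increasing_open[OF step_pos(1)])
    fix x :: real assume "0 < x" "x < h"
    have "(exp x - 1)\<^sup>2 / exp x > 0" using \<open>0 < x\<close> by simp
    moreover have "(exp x - 1)\<^sup>2 / exp x = exp x + exp (- x) - 2"
      by (simp add: power2_eq_square field_simps exp_minus)
    ultimately show "\<exists>y. ((\<lambda>x. exp x - exp (- x) - 2 * x) has_real_derivative y) (at x) \<and> 0 < y"
      by (intro exI[of _ "exp x + exp (- x) - 2"]) (auto intro!: derivative_eq_intros)
  qed (intro continuous_intros)
  then have "0 < exp h * (exp h - exp (- h) - 2 * h)" by simp
  then show "exp h ^ 2 - 1 - 2 * h * exp h > 0"
    by (simp add: power2_eq_square algebra_simps exp_minus)
  have "0 * (exp 0 + 1) - 2 * (exp 0 - 1) < h * (exp h + 1) - 2 * (exp h - 1)"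
  proof (rule DERIV_pos_imp_increasing_open[OF step_pos(1)])
    fix x :: real assume "0 < x" "x < h"
    have "1 - x < exp (- x)" using \<open>0 < x\<close> exp_minus_greater by simp
    then have "exp x * (1 - x) < exp x * exp (- x)" by simp
    then have "0 < x * exp x + 1 - exp x" by (simp add: exp_minus algebra_simps)
    then show "\<exists>y. ((\<lambda>x. x * (exp x + 1) - 2 * (exp x - 1)) has_real_derivative y) (at x) \<and> 0 < y"
      by (intro exI[of _ "x * exp x + 1 - exp x"]) (auto intro!: derivative_eq_intros simp: algebra_simps)
  qed (intro continuous_intros)
  then show "h * (exp h + 1) - 2 * (exp h - 1) > 0" by simp
qed

text \<open>
  These are the integrals of \<open>hat (1 - hat)\<close> and \<open>hat\<^sup>2 + (1 - hat)\<^sup>2\<close>, that is, the off-diagonal and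
  diagonal entries of the Gram matrix of the exponential hat functions.
\<close>

lemma hat_coefficients:
  "hat1 - hat2 = (exp h ^ 2 - 1 - 2 * h * exp h) / (2 * (exp h - 1)\<^sup>2)"
  "h - 2 * (hat1 - hat2) = 2 * (h * (exp h ^ 2 + 1) - (exp h ^ 2 - 1)) / (2 * (exp h - 1)\<^sup>2)"
proof -
  define E where "E = exp h"
  have nz: "E - 1 \<noteq> 0" using step_pos(2) by (simp add: E_def)
  then have nz2: "(E - 1)\<^sup>2 \<noteq> 0" "2 * (E - 1)\<^sup>2 \<noteq> 0" by simp_all
  have "hat1 = 2 * (E - 1 - h) * (E - 1) / (2 * (E - 1)\<^sup>2)"
    unfolding hat1_def E_def[symmetric] by (subst frac_eq_eq[OF nz nz2(2)]) (simp add: power2_eq_square algebra_simps)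
  moreover have "hat2 = ((E ^ 2 - 1) - 4 * (E - 1) + 2 * h) / (2 * (E - 1)\<^sup>2)"
    unfolding hat2_def E_def[symmetric]
    by (subst frac_eq_eq[OF nz2]) (simp add: power2_eq_square algebra_simps diff_divide_distrib add_divide_distrib)
  ultimately have *: "hat1 - hat2 = (E ^ 2 - 1 - 2 * h * E) / (2 * (E - 1)\<^sup>2)"
    by (simp add: diff_divide_distrib[symmetric] power2_eq_square algebra_simps)
  then show "hat1 - hat2 = (exp h ^ 2 - 1 - 2 * h * exp h) / (2 * (exp h - 1)\<^sup>2)"
    by (simp add: E_def)
  have "h - 2 * (X / Y) = (h * Y - 2 * X) / Y" if "Y \<noteq> 0" for X Y
    using that by (simp add: diff_divide_distrib)
  from this[OF nz2(2)]
  have "h - 2 * (hat1 - hat2) = (h * (2 * (E - 1)\<^sup>2) - 2 * (E ^ 2 - 1 - 2 * h * E)) / (2 * (E - 1)\<^sup>2)"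
    unfolding * .
  also have "h * (2 * (E - 1)\<^sup>2) - 2 * (E ^ 2 - 1 - 2 * h * E) = 2 * (h * (E ^ 2 + 1) - (E ^ 2 - 1))"
    by (simp add: power2_eq_square algebra_simps)
  finally show "h - 2 * (hat1 - hat2) = 2 * (h * (exp h ^ 2 + 1) - (exp h ^ 2 - 1)) / (2 * (exp h - 1)\<^sup>2)"
    by (simp add: E_def)
qed

text \<open>Up to a positive factor the equation is M l^2 + 2 X l + M = 0 with 0 < M < X. Its roots
  are (- X + S) / M and (- X - S) / M with S^2 = X^2 - M^2; \<open>lambda1 h\<close> is the first,
  and X - M < S < X places it strictly between -1 and 0.\<close>

lemma lambda1_root:
  "\<bar>lambda1 h\<bar> < 1" "lambda1 h \<noteq> 0"
  "(hat1 - hat2) * ((lambda1 h)\<^sup>2 + 1) + (h - 2 * (hat1 - hat2)) * lambda1 h = 0"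
proof -
  define E where "E = exp h"
  define M where "M = E ^ 2 - 1 - 2 * h * E"
  define X where "X = h * (E ^ 2 + 1) - (E ^ 2 - 1)"
  define Z where "Z = h * (E + 1) - 2 * (E - 1)"
  define R where "R = h\<^sup>2 * (E + 1)\<^sup>2 + 2 * h * (1 - E ^ 2)"
  define S where "S = (E - 1) * sqrt R"
  have "E > 1" "h > 0" using step_pos by (auto simp: E_def)
  have "M > 0" "Z > 0" using step_bounds by (auto simp: M_def Z_def E_def)
  \<comment> \<open>These factorisations identify the radicand in \<open>lambda1\<close> with the
    discriminant and show that it is positive.\<close>
  have XM: "X - M = (E + 1) * Z" "X + M = h * (E - 1)\<^sup>2"
    by (simp_all add: X_def M_def Z_def power2_eq_square algebra_simps)
  have pos: "X - M > 0" "X + M > 0"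
    unfolding XM using \<open>E > 1\<close> \<open>Z > 0\<close> \<open>h > 0\<close> by auto
  have R: "R = h * (E + 1) * Z" by (simp add: R_def Z_def power2_eq_square algebra_simps)
  then have "R > 0" using \<open>E > 1\<close> \<open>Z > 0\<close> \<open>h > 0\<close> by simp
  then have "S > 0" using \<open>E > 1\<close> by (simp add: S_def)
  have "S\<^sup>2 = (E - 1)\<^sup>2 * (h * (E + 1) * Z)"
    using \<open>R > 0\<close> R by (simp add: S_def power_mult_distrib)
  also have "\<dots> = (X - M) * (X + M)" unfolding XM by (simp add: algebra_simps)
  finally have S2: "S\<^sup>2 = (X - M) * (X + M)" .
  have "exp (2 * h) = E ^ 2" by (simp add: E_def exp_double)
  then have "lambda1 h = (X - S) / (- M)"
    by (simp add: lambda1_def X_def S_def R_def M_def E_def[symmetric] algebra_simps)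
  then have lam: "lambda1 h * M = S - X" using \<open>M > 0\<close> by (simp add: field_simps)
  have "S < X"
  proof (rule power2_less_imp_less)
    have "S\<^sup>2 = X\<^sup>2 - M\<^sup>2" unfolding S2 by (simp add: power2_eq_square algebra_simps)
    then show "S\<^sup>2 < X\<^sup>2" using \<open>M > 0\<close> by simp
  qed (use pos in simp)
  have "X - M < S"
  proof (rule power2_less_imp_less)
    show "(X - M)\<^sup>2 < S\<^sup>2" unfolding S2 unfolding power2_eq_square using pos \<open>M > 0\<close> by simp
  qed (use \<open>S > 0\<close> in simp)
  have "lambda1 h * M < 0" "(- 1) * M < lambda1 h * M" using lam \<open>S < X\<close> \<open>X - M < S\<close> by auto
  then have "lambda1 h < 0" "- 1 < lambda1 h"
    using \<open>M > 0\<close> mult_right_less_imp_less[of "- 1" M "lambda1 h"] by (auto simp: mult_less_0_iff)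
  then show "\<bar>lambda1 h\<bar> < 1" "lambda1 h \<noteq> 0" by auto
  have "M * (M * ((lambda1 h)\<^sup>2 + 1) + 2 * X * lambda1 h)
      = (lambda1 h * M)\<^sup>2 + M\<^sup>2 + 2 * X * (lambda1 h * M)"
    by (simp add: power2_eq_square algebra_simps)
  also have "\<dots> = S\<^sup>2 - (X - M) * (X + M)"
    unfolding lam by (simp add: power2_eq_square algebra_simps)
  also have "\<dots> = 0" by (simp add: S2)
  finally have "M * ((lambda1 h)\<^sup>2 + 1) + 2 * X * lambda1 h = 0" using \<open>M > 0\<close> by simp
  then have "(M * ((lambda1 h)\<^sup>2 + 1) + 2 * X * lambda1 h) / (2 * (E - 1)\<^sup>2) = 0" by simp
  moreover have "hat1 - hat2 = M / (2 * (E - 1)\<^sup>2)" "h - 2 * (hat1 - hat2) = 2 * X / (2 * (E - 1)\<^sup>2)"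
    unfolding M_def X_def E_def by (rule hat_coefficients)+
  ultimately show "(hat1 - hat2) * ((lambda1 h)\<^sup>2 + 1) + (h - 2 * (hat1 - hat2)) * lambda1 h = 0"
    by (simp only: add_divide_distrib times_divide_eq_left)
qed

text \<open>The characteristic roots of the recurrence are \<open>lambda1 h\<close> and its
  reciprocal. The constant \<open>h / 2 - hat1\<close> is a particular solution, since the three
  coefficients add up to \<open>h\<close>; the symmetric homogeneous part is scaled to give zero at
  both ends.\<close>

definition nodal_value :: "nat \<Rightarrow> real" where
  "nodal_value k = (h / 2 - hat1) * (1 - (lambda1 h ^ k + lambda1 h ^ (N - k)) / (1 + lambda1 h ^ N))"

lemma one_plus_lambda1_power: "1 + lambda1 h ^ N > 0"
proof -
  have "\<bar>lambda1 h\<bar> ^ N < 1" using lambda1_root(1) N by (intro power_less_one_iff[THEN iffD2]) auto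
  then have "\<bar>lambda1 h ^ N\<bar> < 1" by (simp add: power_abs)
  then show ?thesis by linarith
qed

lemma nodal_value_ends: "nodal_value 0 = 0" "nodal_value N = 0"
  using one_plus_lambda1_power by (simp_all add: nodal_value_def)

lemma nodal_value_recurrence:
  assumes "Suc k < N"
  shows "(hat1 - hat2) * (nodal_value k + nodal_value (Suc (Suc k)))
    + (h - 2 * (hat1 - hat2)) * nodal_value (Suc k) + (h * hat1 - h\<^sup>2 / 2) = 0"
proof -
  define l where "l = lambda1 h"
  define c where "c = h / 2 - hat1"
  define g where "g = c / (1 + l ^ N)"
  define m where "m = hat1 - hat2"
  define d where "d = h - 2 * m"
  \<comment> \<open>Writing \<open>N\<close> this way removes natural-number subtraction from the
    exponents.\<close>
  obtain j where j: "N = k + j + 2" using that[of "N - k - 2"] assms by simp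
  have f: "nodal_value i = c - g * (l ^ i + l ^ (N - i))" for i
    by (simp add: nodal_value_def c_def g_def l_def algebra_simps)
  have root: "m * (l\<^sup>2 + 1) + d * l = 0" using lambda1_root(3) by (simp add: m_def d_def l_def)
  have "m * (nodal_value k + nodal_value (Suc (Suc k))) + d * nodal_value (Suc k)
      = c * (2 * m + d) - g * (l ^ k + l ^ j) * (m * (l\<^sup>2 + 1) + d * l)"
    unfolding f using j by (simp add: power2_eq_square algebra_simps Suc_diff_le)
  also have "\<dots> = c * h" unfolding root by (simp add: d_def)
  also have "\<dots> = - (h * hat1 - h\<^sup>2 / 2)" by (simp add: c_def power2_eq_square algebra_simps)
  finally show ?thesis by (simp add: m_def d_def)
qed

text \<open>Relates \<open>K_factor\<close> to the amplitude of the powers of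
  \<open>lambda1 h\<close> in \<open>nodal_value\<close>, using \<open>h / 2 - hat1 = - (2 * exp h -
  2 - h * exp h - h) / (2 * (exp h - 1))\<close>.\<close>

lemma K_factor_nodal:
  "(exp h - 1) * K_factor N h * lambda1 h = (h / 2 - hat1) / (1 + lambda1 h ^ N) * (1 - lambda1 h)"
proof -
  define l where "l = lambda1 h"
  define E where "E = exp h"
  have nz: "l \<noteq> 0" "E - 1 \<noteq> 0" "1 + l ^ N \<noteq> 0"
    using lambda1_root(2) step_pos(2) one_plus_lambda1_power by (auto simp: l_def E_def)
  have c: "h / 2 - hat1 = - (2 * E - 2 - h * E - h) / (2 * (E - 1))"
    using nz(2) by (simp add: hat1_def E_def[symmetric] field_simps)
  have "l + l ^ (N + 1) = l * (1 + l ^ N)" by (simp add: algebra_simps)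
  then have "(E - 1) * K_factor N h * l
      = ((2 * E - 2 - h * E - h) * (l - 1)) * ((E - 1) * l) / ((2 * (E - 1) * (1 + l ^ N)) * ((E - 1) * l))"
    by (simp add: K_factor_def l_def[symmetric] E_def[symmetric] power2_eq_square ac_simps)
  also have "\<dots> = ((2 * E - 2 - h * E - h) * (l - 1)) / (2 * (E - 1) * (1 + l ^ N))"
    using nz by (intro nonzero_mult_divide_mult_cancel_right) simp
  also have "\<dots> = (h / 2 - hat1) / (1 + l ^ N) * (1 - l)"
  proof -
    have "a * (l - 1) / (b * L) = - a / b / L * (1 - l)" for a b L :: real
      by (simp add: divide_inverse algebra_simps)
    then show ?thesis unfolding c .
  qed
  finally show ?thesis by (simp add: l_def E_def)
qed

section \<open>The coefficients that produce the optimal nodal values\<close>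

definition optimal_solution :: "nat \<Rightarrow> real" where
  "optimal_solution \<beta> = (if \<beta> = 0 then
             1 - h / (exp h - 1) - K_factor N h * (lambda1 h - lambda1 h ^ N)
           else if \<beta> < N then
             h + K_factor N h * ((exp h - lambda1 h) * lambda1 h ^ \<beta>
                                 + (1 - lambda1 h * exp h) * lambda1 h ^ (N - \<beta>))
           else
             - 1 + exp h * (h / (exp h - 1) - K_factor N h * (lambda1 h - lambda1 h ^ N)))"

text \<open>The bracket shared by the first and last coefficients encodes the nodal value next to an
  end; both ends agree by the symmetry between \<open>k\<close> and \<open>N - k\<close>.\<close>

lemma K_factor_end: "(exp h - 1) * (K_factor N h * (lambda1 h - lambda1 h ^ N)) = nodal_value 1"
  "nodal_value (N - 1) = nodal_value 1"
proof -
  define l where "l = lambda1 h"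
  define c where "c = h / 2 - hat1"
  define g where "g = c / (1 + l ^ N)"
  obtain n where n: "N = Suc n" using N by (cases N) auto
  have f: "nodal_value i = c - g * (l ^ i + l ^ (N - i))" for i
    by (simp add: nodal_value_def c_def g_def l_def algebra_simps)
  have c: "c = g * (1 + l * l ^ n)" using one_plus_lambda1_power by (simp add: g_def l_def n)
  have "(exp h - 1) * (K_factor N h * (l - l ^ N)) = ((exp h - 1) * K_factor N h * l) * (1 - l ^ n)"
    by (simp add: n algebra_simps)
  also have "\<dots> = g * (1 - l) * (1 - l ^ n)" using K_factor_nodal by (simp add: g_def c_def l_def)
  also have "\<dots> = nodal_value 1" unfolding f by (subst c) (simp add: n algebra_simps)
  finally show "(exp h - 1) * (K_factor N h * (lambda1 h - lambda1 h ^ N)) = nodal_value 1"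
    by (simp add: l_def)
  show "nodal_value (N - 1) = nodal_value 1" unfolding f by (simp add: n)
qed

text \<open>The right-hand side is \<open>exp h - 1\<close> times the slope jump of
  \<open>kernel_slope_Suc\<close>, with the slopes expressed through nodal values as in
  \<open>peano_kernel_Suc_node\<close>.\<close>

lemma optimal_solution_interior:
  assumes "Suc k < N"
  shows "(exp h - 1) * optimal_solution (Suc k) = h * (exp h - 1)
    - nodal_value (Suc (Suc k)) + (1 + exp h) * nodal_value (Suc k) - exp h * nodal_value k"
proof -
  define l where "l = lambda1 h"
  define E where "E = exp h"
  define c where "c = h / 2 - hat1"
  define g where "g = c / (1 + l ^ N)"
  obtain j where j: "N = k + j + 2" using that[of "N - k - 2"] assms by simp
  have f: "nodal_value i = c - g * (l ^ i + l ^ (N - i))" for i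
    by (simp add: nodal_value_def c_def g_def l_def algebra_simps)
  have "N - Suc k = Suc j" using j by simp
  then have os: "optimal_solution (Suc k) = h + K_factor N h * ((E - l) * (l * l ^ k) + (1 - l * E) * (l * l ^ j))"
    using assms by (simp add: optimal_solution_def E_def l_def)
  have "(E - 1) * optimal_solution (Suc k)
      = (E - 1) * h + ((E - 1) * K_factor N h * l) * ((E - l) * l ^ k + (1 - l * E) * l ^ j)"
    unfolding os by (simp add: algebra_simps)
  also have "(E - 1) * K_factor N h * l = g * (1 - l)"
    using K_factor_nodal by (simp add: g_def c_def l_def E_def)
  also have "(E - 1) * h + g * (1 - l) * ((E - l) * l ^ k + (1 - l * E) * l ^ j)
      = h * (E - 1) - nodal_value (Suc (Suc k)) + (1 + E) * nodal_value (Suc k) - E * nodal_value k"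
    unfolding f using j by (simp add: power2_eq_square algebra_simps Suc_diff_le)
  finally show ?thesis by (simp add: E_def)
qed

text \<open>The slopes are those of the spline through the prescribed nodal values: the first
  coefficient starts the induction and the interior ones carry it on.\<close>

lemma kernel_slope_optimal_solution:
  "k < N \<Longrightarrow> kernel_slope optimal_solution k * (exp h - 1) = h + nodal_value (Suc k) - nodal_value k"
proof (induction k)
  case 0
  have "kernel_slope optimal_solution 0 * (exp h - 1) = h + (exp h - 1) * (K_factor N h * (lambda1 h - lambda1 h ^ N))"
  proof -
    have "(h / (exp h - 1) + T) * (exp h - 1) = h + (exp h - 1) * T" for T
      using step_pos by (simp add: distrib_right)
    then show ?thesis by (simp add: kernel_slope_0 optimal_solution_def)
  qed
  then show ?case using K_factor_end(1) nodal_value_ends(1) by simp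
next
  case (Suc k)
  have "kernel_slope optimal_solution (Suc k) * (exp h - 1)
      = exp h * (kernel_slope optimal_solution k * (exp h - 1)) - (exp h - 1) * optimal_solution (Suc k)"
    by (simp add: kernel_slope_Suc algebra_simps)
  also have "\<dots> = h + nodal_value (Suc (Suc k)) - nodal_value (Suc k)"
    unfolding Suc.IH[OF Suc_lessD[OF Suc.prems]] optimal_solution_interior[OF Suc.prems]
    by (simp add: algebra_simps)
  finally show ?case .
qed

lemma peano_kernel_optimal_solution:
  "k \<le> N \<Longrightarrow> peano_kernel N optimal_solution (h * real k) = nodal_value k"
proof (induction k)
  case 0
  then show ?case by (simp add: peano_kernel_0 nodal_value_ends)
next
  case (Suc k)
  then show ?case
    using peano_kernel_Suc_node[of k optimal_solution] kernel_slope_optimal_solution[of k] by simp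
qed

text \<open>The last coefficient is \<open>exp h\<close> times the slope on the last cell, minus 1,
  which makes the final slope 1; the kernel vanishes at 1 because \<open>nodal_value N\<close>
  does.\<close>

lemma exact_optimal_solution: "exact_on_kernel N optimal_solution"
  unfolding exact_on_kernel_iff
proof
  obtain n where n: "N = Suc n" using N by (cases N) auto
  have "kernel_slope optimal_solution n * (exp h - 1) = h - nodal_value 1"
    using kernel_slope_optimal_solution[of n] nodal_value_ends(2) K_factor_end(2) by (simp add: n)
  then have "kernel_slope optimal_solution n = (h - (exp h - 1) * (K_factor N h * (lambda1 h - lambda1 h ^ N))) / (exp h - 1)"
    using step_pos K_factor_end(1) by (simp add: eq_divide_eq)
  then have "kernel_slope optimal_solution n = h / (exp h - 1) - K_factor N h * (lambda1 h - lambda1 h ^ N)"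
    using step_pos by (simp add: diff_divide_distrib)
  moreover have "optimal_solution N = - 1 + exp h * (h / (exp h - 1) - K_factor N h * (lambda1 h - lambda1 h ^ N))"
    using N by (simp add: optimal_solution_def)
  ultimately show "kernel_slope optimal_solution N = 1"
    using kernel_slope_Suc[of optimal_solution n, folded n] by simp
  show "peano_kernel N optimal_solution 1 = 0"
    using peano_kernel_optimal_solution[of N] nodal_value_ends(2) step_pos(3) by simp
qed

lemma optimal_solution_orthogonal:
  assumes "exact_on_kernel N C"
  shows "integral {0..1} (\<lambda>t. peano_kernel N optimal_solution t
    * (peano_kernel N C t - peano_kernel N optimal_solution t)) = 0"
  using assms exact_optimal_solution nodal_value_recurrence
  by (intro peano_kernel_orthogonal) (simp_all add: peano_kernel_optimal_solution exact_on_kernel_iff del: of_nat_Suc)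

end

theorem theorem5:
  fixes N :: nat and h :: real and C :: "nat \<Rightarrow> real"
  assumes "N \<ge> 1" and "h = 1 / real N"
  shows "\<bar>lambda1 h\<bar> < 1 \<and>
    (optimal_coefficients N C \<longleftrightarrow>
       (\<forall>\<beta>\<le>N. C \<beta> =
          (if \<beta> = 0 then
             1 - h / (exp h - 1) - K_factor N h * (lambda1 h - lambda1 h ^ N)
           else if \<beta> < N then
             h + K_factor N h * ((exp h - lambda1 h) * lambda1 h ^ \<beta>
                                 + (1 - lambda1 h * exp h) * lambda1 h ^ (N - \<beta>))
           else
             - 1 + exp h * (h / (exp h - 1) - K_factor N h * (lambda1 h - lambda1 h ^ N)))))"
proof -
  interpret equidistant_nodes N h using assms by unfold_locales
  have "optimal_coefficients N C \<longleftrightarrow> (\<forall>\<beta>\<le>N. C \<beta> = optimal_solution \<beta>)"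
    using N exact_optimal_solution optimal_solution_orthogonal
      coefficients_eq_of_peano_kernel_eq[OF _ exact_optimal_solution]
    by (rule optimal_coefficients_iff)
  then show ?thesis
    using lambda1_root(1) unfolding optimal_solution_def by blast
qed

end
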